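(* Let $p$ be a prime and $n\ge3$. The nilpotency index of the radical $\mathcal{R}(n,p)$ of the $p$-modular descent algebra $\Sigma(n,p)$ is $n-1$; that is, $\mathcal{R}(n,p)^{n-1}=0$ and $\mathcal{R}(n,p)^{n-2}\ne0$.
   Context: A composition of $n$ is a sequence of positive integers with sum $n$. The descent algebra $\Sigma_n$ has basis $\{B_q\}$ indexed by compositions of $n$ with multiplication $B_qB_r=\sum_{Z\in S(q,r)}B_{c(Z)}$, where for $q=[a_1,\dots,a_s]$, $r=[b_1,\dots,b_t]$, $S(q,r)$ is the set of $s\times t$ non-negative integer matrices with row sums $a_i$ and column sums $b_j$, and $c(Z)$ is the composition obtained by reading the entries of $Z$ row by row and omitting zeros. Let $\mathcal{Z}_n$ be the subring of integral combinations of the $B_q$ and $\Sigma(n,p)=\mathcal{Z}_n/p\mathcal{Z}_n$ (the $p$-modular descent algebra), an $\mathbb{F}_p$-algebra with basis $\overline{B}_q$ (images of $B_q$); $\mathcal{R}(n,p)$ denotes its (Jacobson) radical. The nilpotency index of a nilpotent ideal $\mathcal{R}$ is the least $k$ with $\mathcal{R}^k=0$. *)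

theory Defs
  imports "HOL-Computational_Algebra.Primes"
begin

definition compositions :: "nat \<Rightarrow> nat list set" where
  "compositions n = {q. (\<forall>x\<in>set q. 0 < x) \<and> sum_list q = n}"

definition smat :: "nat list \<Rightarrow> nat list \<Rightarrow> nat list list set" where
  "smat q r = {Z. length Z = length q \<and>
      (\<forall>i<length q. length (Z!i) = length r \<and> sum_list (Z!i) = q!i) \<and>
      (\<forall>j<length r. (\<Sum>i<length q. Z!i!j) = r!j)}"

definition cZ :: "nat list list \<Rightarrow> nat list" where
  "cZ Z = filter (\<lambda>x. x \<noteq> 0) (concat Z)"

text \<open>Structure constant: coefficient of B_u in B_q B_r.\<close>
definition sconst :: "nat list \<Rightarrow> nat list \<Rightarrow> nat list \<Rightarrow> nat" where
  "sconst q r u = card {Z \<in> smat q r. cZ Z = u}"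

text \<open>Sigma(n,p): F_p-linear combinations of the basis elements, represented by
  their coefficient function with values in {0..<p}, supported on compositions of n.\<close>
definition dcarrier :: "nat \<Rightarrow> nat \<Rightarrow> (nat list \<Rightarrow> int) set" where
  "dcarrier n p = {f. (\<forall>q. 0 \<le> f q \<and> f q < int p) \<and> (\<forall>q. q \<notin> compositions n \<longrightarrow> f q = 0)}"

definition dzero :: "nat list \<Rightarrow> int" where
  "dzero = (\<lambda>q. 0)"

definition dadd :: "nat \<Rightarrow> (nat list \<Rightarrow> int) \<Rightarrow> (nat list \<Rightarrow> int) \<Rightarrow> (nat list \<Rightarrow> int)" where
  "dadd p f g = (\<lambda>q. (f q + g q) mod int p)"

definition dneg :: "nat \<Rightarrow> (nat list \<Rightarrow> int) \<Rightarrow> (nat list \<Rightarrow> int)" where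
  "dneg p f = (\<lambda>q. (- f q) mod int p)"

definition dmult :: "nat \<Rightarrow> nat \<Rightarrow> (nat list \<Rightarrow> int) \<Rightarrow> (nat list \<Rightarrow> int) \<Rightarrow> (nat list \<Rightarrow> int)" where
  "dmult n p f g = (\<lambda>u. (\<Sum>q\<in>compositions n. \<Sum>r\<in>compositions n.
        f q * g r * int (sconst q r u)) mod int p)"

definition left_ideal :: "nat \<Rightarrow> nat \<Rightarrow> (nat list \<Rightarrow> int) set \<Rightarrow> bool" where
  "left_ideal n p I \<longleftrightarrow> I \<subseteq> dcarrier n p \<and> dzero \<in> I \<and>
     (\<forall>x\<in>I. \<forall>y\<in>I. dadd p x y \<in> I) \<and> (\<forall>x\<in>I. dneg p x \<in> I) \<and>
     (\<forall>a\<in>dcarrier n p. \<forall>x\<in>I. dmult n p a x \<in> I)"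

definition maximal_left_ideal :: "nat \<Rightarrow> nat \<Rightarrow> (nat list \<Rightarrow> int) set \<Rightarrow> bool" where
  "maximal_left_ideal n p I \<longleftrightarrow> left_ideal n p I \<and> I \<noteq> dcarrier n p \<and>
     (\<forall>J. left_ideal n p J \<and> I \<subseteq> J \<longrightarrow> J = I \<or> J = dcarrier n p)"

definition jrad :: "nat \<Rightarrow> nat \<Rightarrow> (nat list \<Rightarrow> int) set" where
  "jrad n p = dcarrier n p \<inter> \<Inter> {I. maximal_left_ideal n p I}"

inductive_set addclose :: "nat \<Rightarrow> (nat list \<Rightarrow> int) set \<Rightarrow> (nat list \<Rightarrow> int) set"
  for p :: nat and S :: "(nat list \<Rightarrow> int) set" where
  ac_zero: "dzero \<in> addclose p S"
| ac_base: "x \<in> S \<Longrightarrow> x \<in> addclose p S"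
| ac_add: "x \<in> addclose p S \<Longrightarrow> y \<in> addclose p S \<Longrightarrow> dadd p x y \<in> addclose p S"

fun ideal_pow :: "nat \<Rightarrow> nat \<Rightarrow> (nat list \<Rightarrow> int) set \<Rightarrow> nat \<Rightarrow> (nat list \<Rightarrow> int) set" where
  "ideal_pow n p R 0 = dcarrier n p"
| "ideal_pow n p R (Suc 0) = R"
| "ideal_pow n p R (Suc (Suc k)) =
     addclose p {dmult n p a b | a b. a \<in> ideal_pow n p R (Suc k) \<and> b \<in> R}"

end

theory Submission
  imports Defs "HOL-Library.FuncSet" "HOL-Number_Theory.Cong"
begin

text \<open>A matrix Z in S(q,r) with reading word u amounts to two fusions of the parts of u, f onto q and
  g onto r, whose pairs of values (f k, g k) increase strictly in lexicographic order. Hence counting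
  all fusions of l onto q defines a character of the algebra for every composition l. The common
  kernel J of these characters modulo p is the radical: the kernel of a character is a maximal left
  ideal, and J is nilpotent.

  Let y lie in J. Right multiplication by y raises the minimal number of parts, and if q has one part
  fewer than u, the coefficient of u in the product of B_q with y counts (weighted by y) fusions g of
  u with g i < g (i + 1), where q arises from u by merging the parts i and i + 1. So the k-th power
  of J only involves compositions with more than k parts. Among those with n - 1 parts the
  coefficients of an element of the power n - 2 sum to zero, because the contributions cancel in
  pairs related by a permutation of parts; and all of them contribute equally to the only possible
  coefficient of the power n - 1, that of [1,...,1], which therefore vanishes.

  For the lower bound, the element B_[1,n-1] - B_[n-1,1] lies in J, and in its k-th power
  [1,...,1,n-k] has coefficient 1 as long as k is at most n - 2.\<close>

text \<open>The number \<open>card (fusions l q)\<close> counts the cosets of the Young subgroup of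
  type \<open>q\<close> that are fixed by a permutation of cycle type \<open>l\<close>. The
  characters used here are thus Solomon's homomorphism from the descent algebra to class functions,
  evaluated at one class and reduced modulo p.

  Counting parts alone is one step too weak. Compositions of n have up to n parts, so the filtration
  yields only J^n = 0 and leaves the coefficient of [1,...,1] open in J^(n-1). The cancellation
  among compositions with n - 1 parts closes this gap. It acts on products whose last factor lies in
  J, so the exponent n - 2 must be positive. For n = 2 and p = 2 the gain is absent: J is spanned by
  B_[1,1], hence nonzero although n - 1 = 1.

  The radical is defined through maximal left ideals, and placing J inside each of them requires J
  to be nilpotent. The upper bound is therefore proved for J first, and only then is J identified
  with the radical.\<close>

lemma finite_compositions: "finite (compositions n)"
proof (rule finite_subset)
  show "compositions n \<subseteq> {xs. set xs \<subseteq> {..n} \<and> length xs \<le> n}"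
  proof
    fix xs assume xs: "xs \<in> compositions n"
    have "length ys \<le> sum_list ys" if "\<forall>x\<in>set ys. 0 < x" for ys :: "nat list"
      using that by (induction ys) auto
    then show "xs \<in> {xs. set xs \<subseteq> {..n} \<and> length xs \<le> n}"
      using xs by (auto simp: compositions_def intro: member_le_sum_list)
  qed
  show "finite {xs. set xs \<subseteq> {..n} \<and> length xs \<le> n}"
    by (rule finite_lists_length_le) simp
qed

lemma compositions_nth_pos: "u \<in> compositions n \<Longrightarrow> k < length u \<Longrightarrow> 0 < u ! k"
  by (simp add: compositions_def)

lemma compositions_sum: "u \<in> compositions n \<Longrightarrow> (\<Sum>k<length u. u ! k) = n"
  by (simp add: compositions_def sum_list_sum_nth lessThan_atLeast0)

lemma compositionsI:
  "(\<And>k. k < length u \<Longrightarrow> 0 < u ! k) \<Longrightarrow> (\<Sum>k<length u. u ! k) = n \<Longrightarrow> u \<in> compositions n"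
  by (auto simp: compositions_def sum_list_sum_nth lessThan_atLeast0 in_set_conv_nth)

lemma length_composition_le: "u \<in> compositions n \<Longrightarrow> length u \<le> n"
proof -
  assume u: "u \<in> compositions n"
  have "(\<Sum>k<length u. 1) \<le> (\<Sum>k<length u. u ! k)"
    by (rule sum_mono) (use compositions_nth_pos[OF u] in \<open>auto simp: Suc_le_eq\<close>)
  then show ?thesis using compositions_sum[OF u] by simp
qed

lemma composition_length_n:
  assumes u: "u \<in> compositions n" and l: "length u = n"
  shows "u = replicate n 1"
proof (rule nth_equalityI)
  show "length u = length (replicate n 1)" using l by simp
  fix i assume i: "i < length u"
  \<comment> \<open>Truncated subtraction is exact here, since every part is at least 1.\<close>
  have "(\<Sum>k<length u. u ! k - 1) + (\<Sum>k<length u. 1) = (\<Sum>k<length u. u ! k)"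
    unfolding sum.distrib[symmetric]
    by (rule sum.cong) (use compositions_nth_pos[OF u] in \<open>auto simp: Suc_le_eq\<close>)
  then have "(\<Sum>k<length u. u ! k - 1) = 0"
    using compositions_sum[OF u] l by simp
  then have "u ! i - 1 = 0" using i by simp
  then show "u ! i = replicate n 1 ! i"
    using compositions_nth_pos[OF u i] i l by simp
qed

lemma length_composition_pos: "u \<in> compositions n \<Longrightarrow> 0 < n \<Longrightarrow> 0 < length u"
  by (auto simp: compositions_def)

section \<open>Fusing the parts of a composition\<close>

definition fiber_sum :: "nat list \<Rightarrow> (nat \<Rightarrow> nat) \<Rightarrow> nat \<Rightarrow> nat" where
  "fiber_sum u f j = (\<Sum>k\<in>{k\<in>{..<length u}. f k = j}. u ! k)"

definition fuse :: "nat list \<Rightarrow> (nat \<Rightarrow> nat) \<Rightarrow> nat \<Rightarrow> nat list" where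
  "fuse u f s = map (fiber_sum u f) [0..<s]"

text \<open>Extensional maps make the cardinality count maps on the index set only. A fusion is
  automatically onto when the parts of \<open>q\<close> are positive, since an empty fiber has sum
  0.\<close>

definition fusions :: "nat list \<Rightarrow> nat list \<Rightarrow> (nat \<Rightarrow> nat) set" where
  "fusions u q = {f \<in> {..<length u} \<rightarrow>\<^sub>E {..<length q}. \<forall>j<length q. fiber_sum u f j = q ! j}"

lemma length_fuse [simp]: "length (fuse u f s) = s"
  by (simp add: fuse_def)

lemma nth_fuse [simp]: "j < s \<Longrightarrow> fuse u f s ! j = fiber_sum u f j"
  by (simp add: fuse_def)

lemma fiber_sum_cong: "(\<And>k. k < length u \<Longrightarrow> f k = g k) \<Longrightarrow> fiber_sum u f j = fiber_sum u g j"
  by (auto simp: fiber_sum_def intro!: sum.cong)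

lemma fuse_cong: "(\<And>k. k < length u \<Longrightarrow> f k = g k) \<Longrightarrow> fuse u f s = fuse u g s"
  by (auto simp: fuse_def intro!: fiber_sum_cong)

text \<open>A fusion determines its target once the length of the target is known; later this is how
  two compositions are shown to be equal.\<close>

lemma fusions_iff:
  "f \<in> fusions u q \<longleftrightarrow> f \<in> {..<length u} \<rightarrow>\<^sub>E {..<length q} \<and> q = fuse u f (length q)"
  by (auto simp: fusions_def list_eq_iff_nth_eq)

lemma finite_fusions: "finite (fusions u q)"
  by (rule finite_subset[of _ "{..<length u} \<rightarrow>\<^sub>E {..<length q}"])
    (auto simp: fusions_def intro: finite_PiE)

lemma fusions_less: "f \<in> fusions u q \<Longrightarrow> k < length u \<Longrightarrow> f k < length q"
  by (auto simp: fusions_def)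

lemma fusions_fiber: "f \<in> fusions u q \<Longrightarrow> j < length q \<Longrightarrow> fiber_sum u f j = q ! j"
  by (auto simp: fusions_def)

lemma fusions_surj:
  assumes "f \<in> fusions u q" "q \<in> compositions n" "j < length q"
  shows "\<exists>k<length u. f k = j"
proof (rule ccontr)
  assume "\<not> ?thesis"
  then have "{k\<in>{..<length u}. f k = j} = {}" by auto
  then have "fiber_sum u f j = 0" unfolding fiber_sum_def by (simp only: sum.empty)
  then show False
    using fusions_fiber[OF assms(1,3)] compositions_nth_pos[OF assms(2,3)] by simp
qed

lemma fusions_image:
  assumes "f \<in> fusions u q" "q \<in> compositions n"
  shows "f ` {..<length u} = {..<length q}"
  using fusions_surj[OF assms] fusions_less[OF assms(1)] by (auto simp: image_iff; metis)

text \<open>This triangularity is the origin of the filtration by number of parts.\<close>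

lemma fusions_length_le:
  assumes "f \<in> fusions u q" "q \<in> compositions n"
  shows "length q \<le> length u"
  using surj_card_le[of "{..<length u}" "{..<length q}" f] fusions_image[OF assms] by simp

lemma sum_fiber_sum:
  assumes "\<And>k. k < length u \<Longrightarrow> f k < s"
  shows "(\<Sum>j<s. fiber_sum u f j) = (\<Sum>k<length u. u ! k)"
  unfolding fiber_sum_def by (rule sum.group) (use assms in auto)

lemma fuse_composition:
  assumes u: "u \<in> compositions n" and f: "f ` {..<length u} = {..<s}"
  shows "fuse u f s \<in> compositions n"
proof (rule compositionsI)
  fix j assume "j < length (fuse u f s)"
  then have j: "j < s" by simp
  then obtain k where k: "k < length u" "f k = j" using f by (metis imageE lessThan_iff)
  have "u ! k \<le> fiber_sum u f j"
    unfolding fiber_sum_def by (rule member_le_sum) (use k in auto)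
  then show "0 < fuse u f s ! j" using compositions_nth_pos[OF u k(1)] j by simp
next
  have "(\<Sum>j<s. fuse u f s ! j) = (\<Sum>j<s. fiber_sum u f j)" by (rule sum.cong) auto
  also have "\<dots> = (\<Sum>k<length u. u ! k)" by (rule sum_fiber_sum) (use f in auto)
  finally show "(\<Sum>k<length (fuse u f s). fuse u f s ! k) = n"
    using compositions_sum[OF u] by simp
qed

lemma fuse_in_fusions:
  assumes "f \<in> {..<length u} \<rightarrow>\<^sub>E {..<s}"
  shows "f \<in> fusions u (fuse u f s)"
  using assms by (simp add: fusions_iff)

lemma fiber_sum_comp:
  assumes "\<And>k. k < length u \<Longrightarrow> f k < s"
  shows "fiber_sum u (\<lambda>k. g (f k)) j = fiber_sum (fuse u f s) g j"
proof -
  have "fiber_sum (fuse u f s) g j = (\<Sum>i\<in>{i\<in>{..<s}. g i = j}. fiber_sum u f i)"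
    unfolding fiber_sum_def[of "fuse u f s"] by (rule sum.cong) auto
  also have "\<dots> = (\<Sum>i\<in>{i\<in>{..<s}. g i = j}. \<Sum>k\<in>{k \<in> {k\<in>{..<length u}. g (f k) = j}. f k = i}. u ! k)"
    unfolding fiber_sum_def by (intro sum.cong refl arg_cong2[of _ _ _ _ sum]) auto
  also have "\<dots> = fiber_sum u (\<lambda>k. g (f k)) j"
    unfolding fiber_sum_def by (rule sum.group) (use assms in auto)
  finally show ?thesis ..
qed

lemma fuse_fuse:
  assumes "\<And>k. k < length u \<Longrightarrow> f k < s"
  shows "fuse (fuse u f s) g t = fuse u (\<lambda>k. g (f k)) t"
  by (rule nth_equalityI) (simp_all add: fiber_sum_comp[of u f s g, OF assms])

text \<open>Read from left to right, this recognises a map as a fusion when it arises by factoring a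
  known fusion through \<open>f\<close>.\<close>

lemma compose_fusions_iff:
  assumes f: "f \<in> fusions u q" and g: "g \<in> {..<length q} \<rightarrow>\<^sub>E {..<length r}"
  shows "compose {..<length u} g f \<in> fusions u r \<longleftrightarrow> g \<in> fusions q r"
proof -
  have "fuse q g (length r) = fuse (fuse u f (length q)) g (length r)"
    using f fusions_iff by metis
  also have "\<dots> = fuse u (\<lambda>k. g (f k)) (length r)"
    by (rule fuse_fuse) (use fusions_less[OF f] in auto)
  also have "\<dots> = fuse u (compose {..<length u} g f) (length r)"
    by (rule fuse_cong) (simp add: compose_def)
  finally have "fuse q g (length r) = fuse u (compose {..<length u} g f) (length r)" .
  moreover have "compose {..<length u} g f \<in> {..<length u} \<rightarrow>\<^sub>E {..<length r}"
    using f g fusions_less[OF f] by (auto simp: compose_def)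
  ultimately show ?thesis using g by (simp add: fusions_iff)
qed

text \<open>Fiber sums see only the sizes of the parts, so rearranging parts along
  \<open>\<pi>\<close> carries fusions to fusions with the same target. The assumption on
  \<open>P\<close> says that only values at actual indices matter, which makes the extensional
  restriction harmless. The comparisons of counts under permutations of parts all rest on
  this.\<close>

lemma fusions_bij_reindex:
  assumes bij: "bij_betw \<pi> {..<length u} {..<length v}"
    and w: "\<And>k. k < length u \<Longrightarrow> v ! \<pi> k = u ! k"
    and P: "\<And>g g'. (\<And>k. k < length u \<Longrightarrow> g k = g' k) \<Longrightarrow> P g \<longleftrightarrow> P g'"
  shows "card {g \<in> fusions v r. P (\<lambda>k. g (\<pi> k))} =
    card {g \<in> fusions u r. P (\<lambda>k. g k)}"
proof -
  define \<sigma> where "\<sigma> = inv_into {..<length u} \<pi>"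
  have \<sigma>: "bij_betw \<sigma> {..<length v} {..<length u}"
    unfolding \<sigma>_def by (rule bij_betw_inv_into[OF bij])
  have \<sigma>\<pi>: "\<sigma> (\<pi> k) = k" if "k < length u" for k
    unfolding \<sigma>_def using bij that by (simp add: bij_betw_inv_into_left)
  have \<pi>\<sigma>: "\<pi> (\<sigma> k) = k" if "k < length v" for k
    unfolding \<sigma>_def using bij that by (simp add: bij_betw_inv_into_right)
  have \<pi>l: "\<pi> k < length v" if "k < length u" for k
    using bij that by (auto simp: bij_betw_def)
  have \<sigma>l: "\<sigma> k < length u" if "k < length v" for k
    using \<sigma> that by (auto simp: bij_betw_def)
  have fs: "fiber_sum u (\<lambda>k. g (\<pi> k)) j = fiber_sum v g j" for g j
    unfolding fiber_sum_def
    by (rule sum.reindex_bij_witness[of _ \<sigma> \<pi>]) (use \<sigma>\<pi> \<pi>\<sigma> \<pi>l \<sigma>l w in auto)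
  show ?thesis
  proof (rule bij_betw_same_card[of "\<lambda>g. compose {..<length u} g \<pi>"],
      rule bij_betw_byWitness[where f' = "\<lambda>g. compose {..<length v} g \<sigma>"])
    show "\<forall>g\<in>{g \<in> fusions v r. P (\<lambda>k. g (\<pi> k))}.
        compose {..<length v} (compose {..<length u} g \<pi>) \<sigma> = g"
      using \<pi>\<sigma> \<sigma>l by (auto simp: fusions_def compose_def fun_eq_iff PiE_def extensional_def)
    show "\<forall>g\<in>{g \<in> fusions u r. P (\<lambda>k. g k)}.
        compose {..<length u} (compose {..<length v} g \<sigma>) \<pi> = g"
      using \<sigma>\<pi> \<pi>l by (auto simp: fusions_def compose_def fun_eq_iff PiE_def extensional_def)
    show "(\<lambda>g. compose {..<length u} g \<pi>) ` {g \<in> fusions v r. P (\<lambda>k. g (\<pi> k))}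
        \<subseteq> {g \<in> fusions u r. P (\<lambda>k. g k)}"
    proof (rule image_subsetI)
      fix g assume "g \<in> {g \<in> fusions v r. P (\<lambda>k. g (\<pi> k))}"
      then have g: "g \<in> fusions v r" and "P (\<lambda>k. g (\<pi> k))" by auto
      then have "P (compose {..<length u} g \<pi>)"
        using P[of "compose {..<length u} g \<pi>" "\<lambda>k. g (\<pi> k)"] by (simp add: compose_def)
      moreover have "fiber_sum u (compose {..<length u} g \<pi>) j = fiber_sum v g j" for j
        unfolding fs[symmetric] by (rule fiber_sum_cong) (simp add: compose_def)
      ultimately show "compose {..<length u} g \<pi> \<in> {g \<in> fusions u r. P (\<lambda>k. g k)}"
        using g \<pi>l by (auto simp: fusions_def compose_def)
    qed
    show "(\<lambda>g. compose {..<length v} g \<sigma>) ` {g \<in> fusions u r. P (\<lambda>k. g k)}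
        \<subseteq> {g \<in> fusions v r. P (\<lambda>k. g (\<pi> k))}"
    proof (rule image_subsetI)
      fix g assume "g \<in> {g \<in> fusions u r. P (\<lambda>k. g k)}"
      then have g: "g \<in> fusions u r" and "P g" by auto
      then have "P (\<lambda>k. compose {..<length v} g \<sigma> (\<pi> k))"
        using P[of "\<lambda>k. compose {..<length v} g \<sigma> (\<pi> k)" g] \<sigma>\<pi> \<pi>l by (simp add: compose_def)
      moreover have "fiber_sum v (compose {..<length v} g \<sigma>) j = fiber_sum u g j" for j
        unfolding fs[symmetric] by (rule fiber_sum_cong) (simp add: compose_def \<sigma>\<pi> \<pi>l)
      ultimately show "compose {..<length v} g \<sigma> \<in> {g \<in> fusions v r. P (\<lambda>k. g (\<pi> k))}"
        using g \<sigma>l by (auto simp: fusions_def compose_def)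
    qed
  qed
qed

section \<open>Structure constants as pairs of fusions\<close>

text \<open>With \<open>f k\<close> and \<open>g k\<close> the row and column of the k-th nonzero
  entry of a matrix, the condition says that the entries are listed in reading order.\<close>

definition lex_increasing :: "nat \<Rightarrow> (nat \<Rightarrow> nat) \<Rightarrow> (nat \<Rightarrow> nat) \<Rightarrow> bool" where
  "lex_increasing m f g \<longleftrightarrow> (\<forall>a b. a < b \<and> b < m \<longrightarrow> f a < f b \<or> f a = f b \<and> g a < g b)"

definition lex_pairs :: "nat list \<Rightarrow> nat list \<Rightarrow> nat list \<Rightarrow> ((nat \<Rightarrow> nat) \<times> (nat \<Rightarrow> nat)) set" where
  "lex_pairs q r u = {(f, g). f \<in> fusions u q \<and> g \<in> fusions u r \<and> lex_increasing (length u) f g}"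

section \<open>Reading order as arithmetic: the pair (i, j) coded as i * t + j\<close>

lemma concat_map_upt:
  "concat (map (\<lambda>i. map (F i) [0..<t]) [0..<s]) = map (\<lambda>x. F (x div t) (x mod t)) [0..<s * t]"
  (is "?L s = ?R s")
proof (induction s)
  case (Suc s)
  have "[0..<Suc s * t] = [0..<s * t] @ map (\<lambda>j. j + s * t) [0..<t]"
    unfolding map_add_upt using upt_add_eq_append[of 0 "s * t" t] by (simp add: add.commute)
  then show ?case using Suc by (auto simp: div_mult_self1 mult.commute)
qed simp

lemma pair_code_less:
  fixes t :: nat
  assumes "j < t" "j' < t"
  shows "i * t + j < i' * t + j' \<longleftrightarrow> i < i' \<or> i = i' \<and> j < j'"
proof -
  have *: "a * t + b < a' * t + b'" if "a < a'" "b < t" for a a' b b' :: nat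
  proof -
    have "a * t + b < Suc a * t" using that by simp
    also have "\<dots> \<le> a' * t" using that by (intro mult_le_mono1) simp
    finally show ?thesis by simp
  qed
  show ?thesis using *[of i i' j j'] *[of i' i j' j] assms
    by (cases i i' rule: linorder_cases) auto
qed

lemma pair_code_eq:
  fixes t :: nat
  assumes "j < t" "j' < t"
  shows "i * t + j = i' * t + j' \<longleftrightarrow> i = i' \<and> j = j'"
  using pair_code_less[OF assms, of i i'] pair_code_less[OF assms(2,1), of i' i]
  by (metis less_irrefl linorder_neqE_nat)

lemma pair_code_bound: "i < s \<Longrightarrow> j < t \<Longrightarrow> i * t + j < s * (t::nat)"
  using pair_code_less[of j t 0 i s] by (cases t) auto

text \<open>A finite set of numbers has a single increasing enumeration. This turns equality of
  images into pointwise equality of maps, here for positions in a matrix and later for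
  fusions.\<close>

lemma strict_mono_lists_eqI:
  fixes c c' :: "nat \<Rightarrow> nat"
  assumes "\<And>a b. a < b \<Longrightarrow> b < m \<Longrightarrow> c a < c b"
    and "sorted xs" "distinct xs" "set xs = c ` {..<m}"
  shows "xs = map c [0..<m]"
proof (rule sorted_distinct_set_unique)
  show "sorted (map c [0..<m])"
    by (auto simp: sorted_iff_nth_mono_less assms(1) intro: less_imp_le)
  show "distinct (map c [0..<m])"
    by (auto simp: distinct_map inj_on_def) (metis assms(1) linorder_neqE_nat less_irrefl)
qed (use assms in \<open>auto simp: atLeast0LessThan\<close>)

text \<open>Each entry collects all parts with its code, so the margins come out right for any pair
  of fusions. For a lexicographically increasing pair each entry collects at most one part, and the
  nonzero entries are the parts of \<open>u\<close> themselves.\<close>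

definition fusion_matrix ::
    "nat list \<Rightarrow> nat \<Rightarrow> nat \<Rightarrow> (nat \<Rightarrow> nat) \<Rightarrow> (nat \<Rightarrow> nat) \<Rightarrow> nat list list" where
  "fusion_matrix u s t f g = map (\<lambda>i. map (\<lambda>j. fiber_sum u (\<lambda>k. f k * t + g k) (i * t + j)) [0..<t]) [0..<s]"

lemma lex_increasing_code:
  assumes "\<forall>k<m. g k < t"
  shows "lex_increasing m f g \<longleftrightarrow> (\<forall>a b. a < b \<and> b < m \<longrightarrow> f a * t + g a < f b * t + g b)"
proof -
  have "f a * t + g a < f b * t + g b \<longleftrightarrow> f a < f b \<or> f a = f b \<and> g a < g b" if "a < b" "b < m" for a b
    by (rule pair_code_less) (use that assms in auto)
  then show ?thesis unfolding lex_increasing_def by blast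
qed

lemma fusion_matrix_row:
  assumes g: "\<forall>k<length u. g k < t" and i: "i < s"
  shows "sum_list (fusion_matrix u s t f g ! i) = fiber_sum u f i"
proof -
  have "sum_list (fusion_matrix u s t f g ! i) = (\<Sum>j<t. fiber_sum u (\<lambda>k. f k * t + g k) (i * t + j))"
    using i by (simp add: fusion_matrix_def sum_list_sum_nth lessThan_atLeast0)
  also have "\<dots> = (\<Sum>j\<in>{..<t}. \<Sum>k\<in>{k\<in>{k\<in>{..<length u}. f k = i}. g k = j}. u ! k)"
    unfolding fiber_sum_def
  proof (rule sum.cong[OF refl], rule sum.cong[OF _ refl])
    fix j assume "j \<in> {..<t}"
    then have "f k * t + g k = i * t + j \<longleftrightarrow> f k = i \<and> g k = j" if "k < length u" for k
      using g that by (intro pair_code_eq) auto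
    then show "{k \<in> {..<length u}. f k * t + g k = i * t + j} =
        {k \<in> {k \<in> {..<length u}. f k = i}. g k = j}" by auto
  qed
  also have "\<dots> = fiber_sum u f i"
    unfolding fiber_sum_def by (rule sum.group) (use g in auto)
  finally show ?thesis .
qed

lemma fusion_matrix_col:
  assumes f: "\<forall>k<length u. f k < s" and g: "\<forall>k<length u. g k < t" and j: "j < t"
  shows "(\<Sum>i<s. fusion_matrix u s t f g ! i ! j) = fiber_sum u g j"
proof -
  have "(\<Sum>i<s. fusion_matrix u s t f g ! i ! j) = (\<Sum>i<s. fiber_sum u (\<lambda>k. f k * t + g k) (i * t + j))"
    using j by (intro sum.cong) (auto simp: fusion_matrix_def)
  also have "\<dots> = (\<Sum>i\<in>{..<s}. \<Sum>k\<in>{k\<in>{k\<in>{..<length u}. g k = j}. f k = i}. u ! k)"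
    unfolding fiber_sum_def
  proof (rule sum.cong[OF refl], rule sum.cong[OF _ refl])
    fix i assume "i \<in> {..<s}"
    have "f k * t + g k = i * t + j \<longleftrightarrow> f k = i \<and> g k = j" if "k < length u" for k
      using g that j by (intro pair_code_eq) auto
    then show "{k \<in> {..<length u}. f k * t + g k = i * t + j} =
        {k \<in> {k \<in> {..<length u}. g k = j}. f k = i}" by auto
  qed
  also have "\<dots> = fiber_sum u g j"
    unfolding fiber_sum_def by (rule sum.group) (use f in auto)
  finally show ?thesis .
qed

lemma concat_fusion_matrix:
  "concat (fusion_matrix u s t f g) = map (fiber_sum u (\<lambda>k. f k * t + g k)) [0..<s * t]"
  unfolding fusion_matrix_def concat_map_upt by simp

text \<open>Parts are positive, so an entry is nonzero exactly when its position is a code, and the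
  codes increase. The list of positions recovers the pair; this yields both the reading word and
  injectivity.\<close>

lemma fusion_matrix_support:
  assumes u: "u \<in> compositions n"
    and f: "\<forall>k<length u. f k < s" and g: "\<forall>k<length u. g k < t"
    and lex: "lex_increasing (length u) f g"
  shows "filter (\<lambda>x. concat (fusion_matrix u s t f g) ! x \<noteq> 0) [0..<s * t]
    = map (\<lambda>k. f k * t + g k) [0..<length u]"
proof (rule strict_mono_lists_eqI)
  let ?c = "\<lambda>k. f k * t + g k"
  show "?c a < ?c b" if "a < b" "b < length u" for a b
    using lex lex_increasing_code[OF g] that by blast
  have "fiber_sum u ?c x \<noteq> 0 \<longleftrightarrow> x \<in> ?c ` {..<length u}" for x
    using compositions_nth_pos[OF u] by (force simp: fiber_sum_def)
  moreover have "?c k < s * t" if "k < length u" for k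
    using f g that by (simp add: pair_code_bound)
  ultimately show "set (filter (\<lambda>x. concat (fusion_matrix u s t f g) ! x \<noteq> 0) [0..<s * t])
    = ?c ` {..<length u}"
    by (auto simp: concat_fusion_matrix)
qed (auto intro: sorted_filter simp: sorted_wrt_filter)

lemma filter_nth_conv: "filter P xs = map ((!) xs) (filter (\<lambda>x. P (xs ! x)) [0..<length xs])"
proof -
  have "filter P xs = filter P (map ((!) xs) [0..<length xs])" by (simp add: map_nth)
  then show ?thesis by (simp only: filter_map o_def)
qed

lemma cZ_fusion_matrix:
  assumes u: "u \<in> compositions n"
    and f: "\<forall>k<length u. f k < s" and g: "\<forall>k<length u. g k < t"
    and lex: "lex_increasing (length u) f g"
  shows "cZ (fusion_matrix u s t f g) = u"
proof -
  let ?c = "\<lambda>k. f k * t + g k"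
  have mono: "?c a < ?c b" if "a < b" "b < length u" for a b
    using lex lex_increasing_code[OF g] that by blast
  have inj: "?c a = ?c b \<longleftrightarrow> a = b" if "a < length u" "b < length u" for a b
    using mono[of a b] mono[of b a] that by (cases a b rule: linorder_cases) auto
  have fs: "fiber_sum u ?c (?c k) = u ! k" if "k < length u" for k
  proof -
    have "{k' \<in> {..<length u}. ?c k' = ?c k} = {k}" using inj that by auto
    then show ?thesis unfolding fiber_sum_def by (simp only: sum.insert_if) simp
  qed
  have "cZ (fusion_matrix u s t f g) =
    map ((!) (concat (fusion_matrix u s t f g))) (map ?c [0..<length u])"
    unfolding cZ_def
    by (subst filter_nth_conv, subst fusion_matrix_support[OF u f g lex, symmetric])
      (simp_all add: concat_fusion_matrix)
  also have "\<dots> = u"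
    by (rule nth_equalityI) (use fs f g pair_code_bound[of _ s _ t] in \<open>auto simp: concat_fusion_matrix\<close>)
  finally show ?thesis .
qed

lemma fusion_matrix_in_smat:
  assumes "f \<in> fusions u q" "g \<in> fusions u r"
  shows "fusion_matrix u (length q) (length r) f g \<in> smat q r"
proof -
  have fl: "\<forall>k<length u. f k < length q" and gl: "\<forall>k<length u. g k < length r"
    using assms by (simp_all add: fusions_less)
  show ?thesis
    unfolding smat_def
    using fusion_matrix_row[where s = "length q" and f = f, OF gl]
      fusion_matrix_col[where f = f and g = g, OF fl gl]
      fusions_fiber[OF assms(1)] fusions_fiber[OF assms(2)]
    by (simp add: fusion_matrix_def)
qed

text \<open>Flattening forgets the row breaks, but all rows have the length of \<open>r\<close>,
  which restores them.\<close>

lemma smat_eq_map: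
  assumes "Z \<in> smat q r"
  shows "Z = map (\<lambda>i. map (\<lambda>j. concat Z ! (i * length r + j)) [0..<length r]) [0..<length q]"
proof -
  let ?t = "length r"
  have Z: "Z = map (\<lambda>i. map (\<lambda>j. Z ! i ! j) [0..<?t]) [0..<length q]"
    using assms by (intro nth_equalityI) (auto simp: smat_def intro!: nth_equalityI)
  have "concat Z = map (\<lambda>x. Z ! (x div ?t) ! (x mod ?t)) [0..<length q * ?t]"
    by (subst Z, subst concat_map_upt) simp
  then have "concat Z ! (i * ?t + j) = Z ! i ! j" if "i < length q" "j < ?t" for i j
    using pair_code_bound[OF that] that by (cases "length r = 0") (simp_all del: length_0_conv)
  then show ?thesis
    by (subst Z) auto
qed

text \<open>The positions of the nonzero entries of the flattened matrix form an increasing list;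
  quotient and remainder modulo the number of columns are the two fusions.\<close>

lemma smat_fusion_matrix:
  assumes Z: "Z \<in> smat q r" and u: "cZ Z = u"
  shows "\<exists>f g. (f, g) \<in> lex_pairs q r u \<and> Z = fusion_matrix u (length q) (length r) f g"
proof -
  define s t N where "s = length q" and "t = length r" and "N = s * t"
  define ps where "ps = filter (\<lambda>x. concat Z ! x \<noteq> 0) [0..<N]"
  have Zm: "Z = map (\<lambda>i. map (\<lambda>j. concat Z ! (i * t + j)) [0..<t]) [0..<s]"
    using smat_eq_map[OF Z] by (simp add: s_def t_def)
  have lenc: "length (concat Z) = N"
    by (subst Zm, subst concat_map_upt) (simp add: N_def)
  have ups: "u = map ((!) (concat Z)) ps"
    using u unfolding cZ_def ps_def lenc[symmetric] by (subst (asm) filter_nth_conv) simp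
  then have m: "length u = length ps" by simp
  have psN: "ps ! k < N" if "k < length u" for k
    using nth_mem[of k ps] that m by (auto simp: ps_def)
  have psmono: "ps ! a < ps ! b" if "a < b" "b < length u" for a b
  proof -
    have "sorted_wrt (<) ps" by (simp add: ps_def sorted_wrt_filter)
    then show ?thesis using that m by (simp add: sorted_wrt_iff_nth_less)
  qed
  define f where "f = restrict (\<lambda>k. ps ! k div t) {..<length u}"
  define g where "g = restrict (\<lambda>k. ps ! k mod t) {..<length u}"
  have tpos: "0 < t" if "k < length u" for k using psN[OF that] by (cases t) (auto simp: N_def)
  have fl: "\<forall>k<length u. f k < s"
    using psN by (simp add: f_def N_def less_mult_imp_div_less)
  have gl: "\<forall>k<length u. g k < t" using tpos by (simp add: g_def)
  have code: "f k * t + g k = ps ! k" if "k < length u" for k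
    using that by (simp add: f_def g_def)
  have lex: "lex_increasing (length u) f g"
    unfolding lex_increasing_code[OF gl]
  proof (intro allI impI)
    fix a b assume ab: "a < b \<and> b < length u"
    then have "a < length u" by linarith
    then show "f a * t + g a < f b * t + g b" using ab psmono code by simp
  qed
  have fs: "fiber_sum u (\<lambda>k. f k * t + g k) x = concat Z ! x" if x: "x < N" for x
  proof -
    have "fiber_sum u (\<lambda>k. f k * t + g k) x = fiber_sum u ((!) ps) x"
      by (rule fiber_sum_cong) (rule code)
    also have "\<dots> = concat Z ! x"
    proof (cases "x \<in> set ps")
      case True
      then obtain k where k: "k < length u" "ps ! k = x" using m by (auto simp: in_set_conv_nth)
      then have "{k' \<in> {..<length u}. ps ! k' = x} = {k}"
        using psmono by (auto; metis less_irrefl linorder_neqE_nat)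
      then show ?thesis using k ups unfolding fiber_sum_def by (simp only:) simp
    next
      case False
      then have "{k' \<in> {..<length u}. ps ! k' = x} = {}" using m nth_mem[of _ ps] by auto
      then show ?thesis using False x unfolding fiber_sum_def by (simp only:) (simp add: ps_def)
    qed
    finally show ?thesis .
  qed
  have ZM: "Z = fusion_matrix u s t f g"
    unfolding fusion_matrix_def
    by (subst Zm) (use fs pair_code_bound[of _ s _ t] in \<open>auto simp: N_def\<close>)
  have "f \<in> fusions u q"
    unfolding fusions_def using fl fusion_matrix_row[where s = s and f = f, OF gl] Z ZM
    by (auto simp: smat_def s_def f_def)
  moreover have "g \<in> fusions u r"
    unfolding fusions_def using gl fusion_matrix_col[where f = f and g = g, OF fl gl] Z ZM
    by (auto simp: smat_def s_def t_def g_def)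
  ultimately show ?thesis using ZM lex unfolding lex_pairs_def s_def t_def by blast
qed

text \<open>From here on matrices are replaced by pairs of maps, which can be composed with other
  fusions. Positivity of the parts of \<open>u\<close> matters: a part 0 would leave no nonzero
  entry behind.\<close>

lemma sconst_eq_card_lex_pairs:
  assumes u: "u \<in> compositions n"
  shows "sconst q r u = card (lex_pairs q r u)"
  unfolding sconst_def
proof (rule bij_betw_same_card[symmetric])
  let ?M = "\<lambda>(f, g). fusion_matrix u (length q) (length r) f g"
  show "bij_betw ?M (lex_pairs q r u) {Z \<in> smat q r. cZ Z = u}"
    unfolding bij_betw_def
  proof
    show "inj_on ?M (lex_pairs q r u)"
    proof (rule inj_onI, clarify)
      fix f g f' g'
      assume fg: "(f, g) \<in> lex_pairs q r u" and fg': "(f', g') \<in> lex_pairs q r u"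
        and eq: "fusion_matrix u (length q) (length r) f g = fusion_matrix u (length q) (length r) f' g'"
      have F: "f \<in> fusions u q" "f' \<in> fusions u q" and G: "g \<in> fusions u r" "g' \<in> fusions u r"
        and L: "lex_increasing (length u) f g" "lex_increasing (length u) f' g'"
        using fg fg' by (auto simp: lex_pairs_def)
      have fl: "\<forall>k<length u. f k < length q" "\<forall>k<length u. f' k < length q"
        and gl: "\<forall>k<length u. g k < length r" "\<forall>k<length u. g' k < length r"
        using F G by (simp_all add: fusions_less)
      have "map (\<lambda>k. f k * length r + g k) [0..<length u] = map (\<lambda>k. f' k * length r + g' k) [0..<length u]"
        using fusion_matrix_support[OF u fl(1) gl(1) L(1)] fusion_matrix_support[OF u fl(2) gl(2) L(2)] eq
        by simp
      then have "f k * length r + g k = f' k * length r + g' k" if "k < length u" for k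
        using that by simp
      then have fg_eq: "f k = f' k \<and> g k = g' k" if "k < length u" for k
        using pair_code_eq gl that by blast
      show "f = f' \<and> g = g'"
        using F G fg_eq by (auto simp: fusions_def intro: PiE_ext)
    qed
    show "?M ` lex_pairs q r u = {Z \<in> smat q r. cZ Z = u}"
    proof (rule antisym)
      show "?M ` lex_pairs q r u \<subseteq> {Z \<in> smat q r. cZ Z = u}"
        using fusion_matrix_in_smat cZ_fusion_matrix[OF u] fusions_less
        by (auto simp: lex_pairs_def)
      show "{Z \<in> smat q r. cZ Z = u} \<subseteq> ?M ` lex_pairs q r u"
      proof clarify
        fix Z assume "Z \<in> smat q r" "u = cZ Z"
        then obtain f g where "(f, g) \<in> lex_pairs q r (cZ Z)"
            "Z = fusion_matrix (cZ Z) (length q) (length r) f g"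
          using smat_fusion_matrix by blast
        then show "Z \<in> (\<lambda>(f, g). fusion_matrix (cZ Z) (length q) (length r) f g) ` lex_pairs q r (cZ Z)"
          by (intro image_eqI[of _ _ "(f, g)"]) auto
      qed
    qed
  qed
qed

section \<open>Unique factorisation of pairs of fusions\<close>

lemma pair_code_div: "j < t \<Longrightarrow> (i * t + j) div t = i" for t :: nat
  by simp

lemma pair_code_mod: "j < t \<Longrightarrow> (i * t + j) mod t = j" for t :: nat
  by simp

lemma strict_mono_map_upt:
  fixes c :: "nat \<Rightarrow> nat"
  assumes "\<And>a b. a < b \<Longrightarrow> b < m \<Longrightarrow> c a < c b"
  shows "map c [0..<m] = sorted_list_of_set (c ` {..<m})"
  by (rule strict_mono_lists_eqI[symmetric]) (use assms in auto)

lemma lex_pairs_code: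
  assumes "(f, g) \<in> lex_pairs q r u" "a < b" "b < length u"
  shows "f a * length r + g a < f b * length r + g b"
proof -
  have "\<forall>k<length u. g k < length r" using assms(1) by (auto simp: lex_pairs_def fusions_less)
  from lex_increasing_code[OF this, of f] show ?thesis
    using assms by (simp add: lex_pairs_def)
qed

lemma finite_lex_pairs: "finite (lex_pairs q r u)"
  by (rule finite_subset[of _ "fusions u q \<times> fusions u r"])
    (auto simp: lex_pairs_def finite_fusions)

text \<open>Since \<open>h\<close> is onto, the codes of (f, g) are the codes of the composed pair,
  listed increasingly. They are distinct and hence determine \<open>h\<close>, and \<open>h\<close>
  determines \<open>u\<close> as the fused composition.\<close>

lemma inj_on_compose_lex_pairs:
  "inj_on (\<lambda>(u, h, f, g). (compose {..<length l} f h, compose {..<length l} g h))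
    (SIGMA u:compositions n. fusions l u \<times> lex_pairs q r u)"
proof (rule inj_onI)
  let ?D = "SIGMA u:compositions n. fusions l u \<times> lex_pairs q r u"
  let ?\<Phi> = "\<lambda>(u, h, f, g). (compose {..<length l} f h, compose {..<length l} g h)"
  fix x x' assume xD: "x \<in> ?D" and xD': "x' \<in> ?D" and xx': "?\<Phi> x = ?\<Phi> x'"
  obtain u h f g where x: "x = (u, h, f, g)" by (cases x)
  obtain u' h' f' g' where x': "x' = (u', h', f', g')" by (cases x')
  have u: "u \<in> compositions n" and h: "h \<in> fusions l u" and fg: "(f, g) \<in> lex_pairs q r u"
    and u': "u' \<in> compositions n" and h': "h' \<in> fusions l u'" and fg': "(f', g') \<in> lex_pairs q r u'"
    and eq: "compose {..<length l} f h = compose {..<length l} f' h'"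
      "compose {..<length l} g h = compose {..<length l} g' h'"
    using xD xD' xx' by (auto simp: x x')
  define c where "c k = f k * length r + g k" for k
  define c' where "c' k = f' k * length r + g' k" for k
  have cl: "c a < c b" if "a < b" "b < length u" for a b
    using lex_pairs_code[OF fg that] by (simp add: c_def)
  have cl': "c' a < c' b" if "a < b" "b < length u'" for a b
    using lex_pairs_code[OF fg' that] by (simp add: c'_def)
  have ch: "c (h a) = c' (h' a)" if "a < length l" for a
    using fun_cong[OF eq(1), of a] fun_cong[OF eq(2), of a] that
    by (simp add: c_def c'_def compose_def)
  have "c ` {..<length u} = (\<lambda>a. c (h a)) ` {..<length l}"
    using fusions_image[OF h u] by (metis image_image)
  also have "\<dots> = (\<lambda>a. c' (h' a)) ` {..<length l}" using ch by simp
  also have "\<dots> = c' ` {..<length u'}"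
    using fusions_image[OF h' u'] by (metis image_image)
  finally have map: "map c [0..<length u] = map c' [0..<length u']"
    using strict_mono_map_upt[of "length u" c, OF cl] strict_mono_map_upt[of "length u'" c', OF cl'] by simp
  then have len: "length u = length u'" using map_eq_imp_length_eq[OF map] by simp
  have cc': "c k = c' k" if "k < length u" for k
    using map that unfolding len by simp
  have "h a = h' a" if "a < length l" for a
  proof -
    have "c (h a) = c (h' a)" and "h a < length u" "h' a < length u"
      using ch[OF that] cc' fusions_less[OF h that] fusions_less[OF h' that] len by auto
    then show ?thesis using cl[of "h a" "h' a"] cl[of "h' a" "h a"]
      by (cases "h a" "h' a" rule: linorder_cases) auto
  qed
  then have hh': "h = h'" using h h' len by (auto simp: fusions_def intro: PiE_ext)
  have uu': "u = u'"
    using h h' len unfolding hh' by (metis fusions_iff)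
  have "f k = f' k \<and> g k = g' k" if "k < length u" for k
  proof -
    have "g k < length r" "g' k < length r"
      using fg fg' that by (auto simp: lex_pairs_def fusions_less uu')
    then show ?thesis using cc'[OF that] pair_code_eq by (simp add: c_def c'_def)
  qed
  then have "f = f' \<and> g = g'"
    using fg fg' uu' by (auto simp: lex_pairs_def fusions_def intro: PiE_ext)
  then show "x = x'" using hh' uu' by (simp add: x x')
qed

text \<open>Image factorisation of the pair (f', g'): parts of \<open>l\<close> with the same pair
  of values are fused, and the resulting parts are ordered by their codes, which forces
  lexicographic increase.\<close>

lemma compose_lex_pairs_surj:
  assumes l: "l \<in> compositions n" and f': "f' \<in> fusions l q" and g': "g' \<in> fusions l r"
  shows "\<exists>u h f g. u \<in> compositions n \<and> h \<in> fusions l u \<and> (f, g) \<in> lex_pairs q r u \<and>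
    f' = compose {..<length l} f h \<and> g' = compose {..<length l} g h"
proof -
  define L where "L = length l"
  define c where "c a = f' a * length r + g' a" for a
  define ps where "ps = sorted_list_of_set (c ` {..<L})"
  define m where "m = length ps"
  have setps: "set ps = c ` {..<L}" by (simp add: ps_def)
  have psless: "ps ! a < ps ! b" if "a < b" "b < m" for a b
    using that strict_sorted_list_of_set[of "c ` {..<L}"]
    by (simp add: ps_def m_def sorted_wrt_iff_nth_less)
  have inj: "a = b" if "ps ! a = ps ! b" "a < m" "b < m" for a b
    using psless[of a b] psless[of b a] that by (cases a b rule: linorder_cases) auto
  have "\<exists>k<m. ps ! k = c a" if "a < L" for a
    using that setps by (auto simp: m_def in_set_conv_nth[symmetric])
  then obtain h0 where h0: "h0 a < m" "ps ! h0 a = c a" if "a < L" for a by metis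
  define h where "h = restrict h0 {..<L}"
  have hE: "h \<in> {..<L} \<rightarrow>\<^sub>E {..<m}" using h0 by (auto simp: h_def)
  have hc: "ps ! h a = c a" if "a < L" for a using h0 that by (simp add: h_def)
  have him: "h ` {..<L} = {..<m}"
  proof (rule antisym)
    show "h ` {..<L} \<subseteq> {..<m}" using hE by auto
    show "{..<m} \<subseteq> h ` {..<L}"
    proof
      fix k assume k: "k \<in> {..<m}"
      then have "ps ! k \<in> c ` {..<L}" using nth_mem[of k ps] setps by (simp add: m_def)
      then obtain a where a: "a < L" "ps ! k = c a" by auto
      then have "h a = k" using inj[of "h a" k] hc[OF a(1)] hE k by auto
      then show "k \<in> h ` {..<L}" using a by auto
    qed
  qed
  define u where "u = fuse l h m"
  have lenu: "length u = m" by (simp add: u_def)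
  have u: "u \<in> compositions n" unfolding u_def by (rule fuse_composition[OF l]) (use him in \<open>simp add: L_def\<close>)
  have h: "h \<in> fusions l u" unfolding u_def by (rule fuse_in_fusions) (use hE in \<open>simp add: L_def\<close>)
  have rep: "\<exists>a<L. h a = k" if "k < m" for k using him that by (metis imageE lessThan_iff)
  define f where "f = restrict (\<lambda>k. ps ! k div length r) {..<m}"
  define g where "g = restrict (\<lambda>k. ps ! k mod length r) {..<m}"
  have fh: "f (h a) = f' a" and gh: "g (h a) = g' a" if "a < L" for a
  proof -
    have "g' a < length r" using fusions_less[OF g'] that by (simp add: L_def)
    then have "c a div length r = f' a" "c a mod length r = g' a"
      unfolding c_def by (rule pair_code_div, rule pair_code_mod)
    then show "f (h a) = f' a" "g (h a) = g' a"
      using hc[OF that] hE that by (auto simp: f_def g_def)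
  qed
  have cf: "f' = compose {..<length l} f h" and cg: "g' = compose {..<length l} g h"
    using f' g' fh gh by (auto simp: fusions_def L_def compose_def PiE_def extensional_def fun_eq_iff)
  have fE: "f \<in> {..<length u} \<rightarrow>\<^sub>E {..<length q}" and gE: "g \<in> {..<length u} \<rightarrow>\<^sub>E {..<length r}"
  proof -
    have "f k < length q \<and> g k < length r" if "k < m" for k
      using rep[OF that] fh gh fusions_less[OF f'] fusions_less[OF g'] by (auto simp: L_def)
    then show "f \<in> {..<length u} \<rightarrow>\<^sub>E {..<length q}" "g \<in> {..<length u} \<rightarrow>\<^sub>E {..<length r}"
      by (auto simp: lenu f_def g_def)
  qed
  have "f \<in> fusions u q" "g \<in> fusions u r"
    using compose_fusions_iff[OF h fE] compose_fusions_iff[OF h gE] f' g' cf cg by auto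
  moreover have "lex_increasing (length u) f g"
  proof -
    have "\<forall>k<length u. g k < length r" using gE by auto
    moreover have "f k * length r + g k = ps ! k" if "k < m" for k
      using that by (simp add: f_def g_def)
    ultimately show ?thesis
      using psless by (subst lex_increasing_code[of _ _ "length r"]) (auto simp: lenu)
  qed
  ultimately show ?thesis using u h cf cg unfolding lex_pairs_def by blast
qed

text \<open>Both sides count pairs of fusions of \<open>l\<close>, the left side after factoring
  each pair uniquely through a lexicographically increasing one. This is multiplicativity of the
  character of \<open>l\<close> on basis elements.\<close>

lemma sum_card_fusions_mult_sconst:
  assumes l: "l \<in> compositions n"
  shows "(\<Sum>u\<in>compositions n. card (fusions l u) * sconst q r u) = card (fusions l q) * card (fusions l r)"
proof -
  let ?\<Phi> = "\<lambda>(u, h, f, g). (compose {..<length l} f h, compose {..<length l} g h)"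
  let ?D = "SIGMA u:compositions n. fusions l u \<times> lex_pairs q r u"
  have "(\<Sum>u\<in>compositions n. card (fusions l u) * sconst q r u) = card ?D"
    by (simp add: finite_compositions finite_fusions finite_lex_pairs card_cartesian_product
        sconst_eq_card_lex_pairs)
  also have "\<dots> = card (fusions l q \<times> fusions l r)"
  proof (rule bij_betw_same_card[of ?\<Phi>])
    have "?\<Phi> ` ?D = fusions l q \<times> fusions l r"
    proof (rule antisym)
      have "compose {..<length l} f h \<in> fusions l q" if "h \<in> fusions l u" "f \<in> fusions u q" for h u f q
        using compose_fusions_iff[OF that(1), of f q] that(2) by (simp add: fusions_def)
      then show "?\<Phi> ` ?D \<subseteq> fusions l q \<times> fusions l r"
        by (auto simp: lex_pairs_def)
      show "fusions l q \<times> fusions l r \<subseteq> ?\<Phi> ` ?D"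
      proof clarify
        fix f' g' assume "f' \<in> fusions l q" "g' \<in> fusions l r"
        from compose_lex_pairs_surj[OF l this] obtain u h f g where
          "u \<in> compositions n" "h \<in> fusions l u" "(f, g) \<in> lex_pairs q r u"
          "f' = compose {..<length l} f h" "g' = compose {..<length l} g h" by blast
        then show "(f', g') \<in> ?\<Phi> ` ?D"
          by (intro image_eqI[of _ _ "(u, h, f, g)"]) auto
      qed
    qed
    then show "bij_betw ?\<Phi> ?D (fusions l q \<times> fusions l r)"
      using inj_on_compose_lex_pairs by (simp add: bij_betw_def)
  qed
  finally show ?thesis by (simp add: card_cartesian_product)
qed

section \<open>Characters and the radical\<close>

text \<open>The condition \<open>P\<close> lets one notion serve both for the characters, where it
  is trivial, and for the coefficients of products, where it compares two neighbouring values. The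
  value is an unreduced integer; all statements about it modulo p are congruences.\<close>

definition fusion_count :: "nat \<Rightarrow> nat list \<Rightarrow> ((nat \<Rightarrow> nat) \<Rightarrow> bool) \<Rightarrow> (nat list \<Rightarrow> int) \<Rightarrow> int" where
  "fusion_count n u P y = (\<Sum>r\<in>compositions n. y r * int (card {g \<in> fusions u r. P g}))"

abbreviation character :: "nat \<Rightarrow> nat list \<Rightarrow> (nat list \<Rightarrow> int) \<Rightarrow> int" where
  "character n l \<equiv> fusion_count n l (\<lambda>_. True)"

definition character_kernel :: "nat \<Rightarrow> nat \<Rightarrow> nat list \<Rightarrow> (nat list \<Rightarrow> int) set" where
  "character_kernel n p l = {y \<in> dcarrier n p. [character n l y = 0] (mod int p)}"

definition common_kernel :: "nat \<Rightarrow> nat \<Rightarrow> (nat list \<Rightarrow> int) set" where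
  "common_kernel n p = {y \<in> dcarrier n p. \<forall>l\<in>compositions n. [character n l y = 0] (mod int p)}"

lemma fusion_count_cong:
  "(\<And>q. [x q = y q] (mod int p)) \<Longrightarrow> [fusion_count n l P x = fusion_count n l P y] (mod int p)"
  unfolding fusion_count_def by (intro cong_sum cong_mult cong_refl)

lemma fusion_count_add: "fusion_count n l P (\<lambda>q. x q + y q) = fusion_count n l P x + fusion_count n l P y"
  by (simp add: fusion_count_def sum.distrib distrib_right)

lemma fusion_count_minus: "fusion_count n l P (\<lambda>q. - x q) = - fusion_count n l P x"
  by (simp add: fusion_count_def sum_negf)

lemma fusion_count_dadd:
  "[fusion_count n l P (dadd p x y) = fusion_count n l P x + fusion_count n l P y] (mod int p)"
  unfolding fusion_count_add[symmetric] by (rule fusion_count_cong) (simp add: dadd_def cong_def)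

lemma fusion_count_dneg:
  "[fusion_count n l P (dneg p x) = - fusion_count n l P x] (mod int p)"
  unfolding fusion_count_minus[symmetric] by (rule fusion_count_cong) (simp add: dneg_def cong_def)

lemma fusion_count_dzero [simp]: "fusion_count n l P dzero = 0"
  by (simp add: fusion_count_def dzero_def)

lemma character_dmult:
  assumes "l \<in> compositions n"
  shows "[character n l (dmult n p x y) = character n l x * character n l y] (mod int p)"
proof -
  let ?C = "compositions n" and ?c = "\<lambda>u. int (card (fusions l u))"
  have "[character n l (dmult n p x y) =
      (\<Sum>u\<in>?C. (\<Sum>q\<in>?C. \<Sum>r\<in>?C. x q * y r * int (sconst q r u)) * ?c u)] (mod int p)"
    unfolding fusion_count_def
    by (intro cong_sum cong_mult) (simp_all add: dmult_def cong_def)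
  also have "(\<Sum>u\<in>?C. (\<Sum>q\<in>?C. \<Sum>r\<in>?C. x q * y r * int (sconst q r u)) * ?c u) =
      (\<Sum>u\<in>?C. \<Sum>q\<in>?C. \<Sum>r\<in>?C. x q * y r * (?c u * int (sconst q r u)))"
    by (simp add: sum_distrib_right sum_distrib_left mult_ac)
  also have "\<dots> = (\<Sum>q\<in>?C. \<Sum>r\<in>?C. \<Sum>u\<in>?C. x q * y r * (?c u * int (sconst q r u)))"
    by (subst sum.swap, rule sum.cong[OF refl], rule sum.swap)
  also have "\<dots> = (\<Sum>q\<in>?C. \<Sum>r\<in>?C. x q * y r * int (\<Sum>u\<in>?C. card (fusions l u) * sconst q r u))"
    by (simp add: sum_distrib_left)
  also have "\<dots> = character n l x * character n l y"
    unfolding sum_card_fusions_mult_sconst[OF assms]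
    by (simp add: fusion_count_def sum_product mult_ac)
  finally show ?thesis .
qed

section \<open>The ring operations on the carrier and the identity element\<close>

lemma cZ_in_compositions:
  assumes "Z \<in> smat q r" "q \<in> compositions n"
  shows "cZ Z \<in> compositions n"
proof -
  have *: "sum_list (filter (\<lambda>x. x \<noteq> 0) xs) = sum_list xs" for xs :: "nat list"
    by (induction xs) auto
  have cat: "sum_list (concat xss) = sum_list (map sum_list xss)" for xss :: "nat list list"
    by (induction xss) auto
  have "map sum_list Z = q" using assms(1) by (auto simp: smat_def intro: nth_equalityI)
  then show ?thesis
    using assms(2) by (auto simp: compositions_def cZ_def * cat simp del: neq0_conv)
qed

lemma dmult_dcarrier: "0 < p \<Longrightarrow> dmult n p x y \<in> dcarrier n p"
proof -
  assume p: "0 < p"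
  have "sconst q r u = 0" if "q \<in> compositions n" "u \<notin> compositions n" for q r u
  proof -
    have "{Z \<in> smat q r. cZ Z = u} = {}" using cZ_in_compositions[OF _ that(1)] that(2) by auto
    then show ?thesis unfolding sconst_def by (simp only: card.empty)
  qed
  then show ?thesis using p by (auto simp: dcarrier_def dmult_def)
qed

lemma dadd_dcarrier: "x \<in> dcarrier n p \<Longrightarrow> y \<in> dcarrier n p \<Longrightarrow> 0 < p \<Longrightarrow> dadd p x y \<in> dcarrier n p"
  by (auto simp: dcarrier_def dadd_def)

lemma dneg_dcarrier: "x \<in> dcarrier n p \<Longrightarrow> 0 < p \<Longrightarrow> dneg p x \<in> dcarrier n p"
  by (auto simp: dcarrier_def dneg_def)

lemma dzero_dcarrier: "0 < p \<Longrightarrow> dzero \<in> dcarrier n p"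
  by (auto simp: dcarrier_def dzero_def)

lemma dcarrier_mod: "x \<in> dcarrier n p \<Longrightarrow> x q mod int p = x q"
  by (simp add: dcarrier_def)

lemma dmult_dadd_right: "dmult n p x (dadd p y z) = dadd p (dmult n p x y) (dmult n p x z)"
proof
  fix u
  let ?C = "compositions n"
  have "[(\<Sum>q\<in>?C. \<Sum>r\<in>?C. x q * dadd p y z r * int (sconst q r u)) =
      (\<Sum>q\<in>?C. \<Sum>r\<in>?C. x q * (y r + z r) * int (sconst q r u))] (mod int p)"
    by (intro cong_sum cong_mult cong_refl) (simp add: dadd_def cong_def)
  then show "dmult n p x (dadd p y z) u = dadd p (dmult n p x y) (dmult n p x z) u"
    by (simp add: dmult_def dadd_def cong_def mod_add_eq sum.distrib distrib_left distrib_right)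
qed

text \<open>This basis element is the identity: a matrix with a single row or a single column is
  determined by its margins.\<close>

definition dunit :: "nat \<Rightarrow> nat list \<Rightarrow> int" where
  "dunit n = (\<lambda>q. if q = [n] then 1 else 0)"

lemma singleton_composition: "0 < n \<Longrightarrow> [n] \<in> compositions n"
  by (simp add: compositions_def)

lemma dunit_dcarrier: "0 < n \<Longrightarrow> 1 < p \<Longrightarrow> dunit n \<in> dcarrier n p"
  by (auto simp: dunit_def dcarrier_def singleton_composition)

lemma strict_mono_fusion:
  assumes f: "f \<in> fusions u q" and q: "q \<in> compositions n"
    and mono: "\<And>a b. a < b \<Longrightarrow> b < length u \<Longrightarrow> f a < f b"
  shows "q = u \<and> f = restrict (\<lambda>k. k) {..<length u}"
proof -
  have eq: "[0..<length q] = map f [0..<length u]"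
    by (rule strict_mono_lists_eqI[OF mono]) (use fusions_image[OF f q] in auto)
  then have len: "length q = length u" by (metis length_map length_upt minus_nat.diff_0)
  have id: "f k = k" if "k < length u" for k
    using arg_cong[OF eq, of "\<lambda>xs. xs ! k"] that len by simp
  have "q = fuse u (\<lambda>k. k) (length u)"
    using f len id by (metis fusions_iff fuse_cong)
  also have "\<dots> = u"
  proof (rule nth_equalityI)
    fix k assume "k < length (fuse u (\<lambda>k. k) (length u))"
    then have "k < length u" and "{k' \<in> {..<length u}. k' = k} = {k}" by auto
    then show "fuse u (\<lambda>k. k) (length u) ! k = u ! k"
      by (simp only: nth_fuse fiber_sum_def) simp
  qed simp
  finally have "q = u" .
  moreover have "f = restrict (\<lambda>k. k) {..<length u}"
  proof
    fix k
    show "f k = restrict (\<lambda>k. k) {..<length u} k"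
      using f id by (cases "k < length u") (auto simp: fusions_def PiE_def extensional_def)
  qed
  ultimately show ?thesis ..
qed

lemma identity_fusion: "restrict (\<lambda>k. k) {..<length u} \<in> fusions u u"
proof -
  have "{k \<in> {..<length u}. restrict (\<lambda>k. k) {..<length u} k = j} = {j}" if "j < length u" for j
    using that by auto
  then have "fiber_sum u (restrict (\<lambda>k. k) {..<length u}) j = u ! j" if "j < length u" for j
    using that by (simp only: fiber_sum_def) simp
  then show ?thesis by (auto simp: fusions_def)
qed

lemma fusions_singleton:
  assumes "u \<in> compositions n"
  shows "fusions u [n] = {restrict (\<lambda>_. 0) {..<length u}}"
proof -
  have "fiber_sum u (restrict (\<lambda>_. 0) {..<length u}) 0 = n"
    using compositions_sum[OF assms] by (subst fiber_sum_cong[of _ _ "\<lambda>_. 0"]) (auto simp: fiber_sum_def lessThan_def)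
  then have "restrict (\<lambda>_. 0) {..<length u} \<in> fusions u [n]"
    by (simp add: fusions_def)
  moreover have "f = restrict (\<lambda>_. 0) {..<length u}" if "f \<in> fusions u [n]" for f
  proof
    fix k
    show "f k = restrict (\<lambda>_. 0) {..<length u} k"
      using that by (cases "k < length u") (auto simp: fusions_def PiE_def Pi_def extensional_def)
  qed
  ultimately show ?thesis by blast
qed

text \<open>The only fusion onto \<open>[n]\<close> is constant, so lexicographic increase makes the
  other map strictly increasing, hence the identity.\<close>

lemma sconst_unit_left:
  assumes "u \<in> compositions n" "r \<in> compositions n"
  shows "sconst [n] r u = (if r = u then 1 else 0)"
proof -
  let ?z = "restrict (\<lambda>_. 0) {..<length u}" and ?i = "restrict (\<lambda>k. k) {..<length u}"
  have "r = u \<and> f = ?z \<and> g = ?i" if "(f, g) \<in> lex_pairs [n] r u" for f g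
  proof -
    have F: "f \<in> fusions u [n]" and G: "g \<in> fusions u r" and lex: "lex_increasing (length u) f g"
      using that unfolding lex_pairs_def by blast+
    have z: "f = ?z" using F unfolding fusions_singleton[OF assms(1)] by blast
    have "g a < g b" if "a < b" "b < length u" for a b
      using lex that unfolding z lex_increasing_def by fastforce
    then show ?thesis using strict_mono_fusion[OF G assms(2)] z by blast
  qed
  moreover have "(?z, ?i) \<in> lex_pairs [n] r u" if "r = u"
  proof -
    have "?z \<in> fusions u [n]" unfolding fusions_singleton[OF assms(1)] by blast
    moreover have "?i \<in> fusions u r" using that identity_fusion by blast
    ultimately show ?thesis by (simp add: lex_pairs_def lex_increasing_def)
  qed
  ultimately have "lex_pairs [n] r u = (if r = u then {(?z, ?i)} else {})"
    by (auto simp del: split_paired_All)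
  then show ?thesis by (simp add: sconst_eq_card_lex_pairs[OF assms(1)])
qed

lemma sconst_unit_right:
  assumes "u \<in> compositions n" "q \<in> compositions n"
  shows "sconst q [n] u = (if q = u then 1 else 0)"
proof -
  let ?z = "restrict (\<lambda>_. 0) {..<length u}" and ?i = "restrict (\<lambda>k. k) {..<length u}"
  have "q = u \<and> f = ?i \<and> g = ?z" if "(f, g) \<in> lex_pairs q [n] u" for f g
  proof -
    have F: "f \<in> fusions u q" and G: "g \<in> fusions u [n]" and lex: "lex_increasing (length u) f g"
      using that unfolding lex_pairs_def by blast+
    have z: "g = ?z" using G unfolding fusions_singleton[OF assms(1)] by blast
    have "f a < f b" if "a < b" "b < length u" for a b
      using lex that unfolding z lex_increasing_def by fastforce
    then show ?thesis using strict_mono_fusion[OF F assms(2)] z by blast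
  qed
  moreover have "(?i, ?z) \<in> lex_pairs q [n] u" if "q = u"
  proof -
    have "?z \<in> fusions u [n]" unfolding fusions_singleton[OF assms(1)] by blast
    moreover have "?i \<in> fusions u q" using that identity_fusion by blast
    ultimately show ?thesis by (simp add: lex_pairs_def lex_increasing_def)
  qed
  ultimately have "lex_pairs q [n] u = (if q = u then {(?i, ?z)} else {})"
    by (auto simp del: split_paired_All)
  then show ?thesis by (simp add: sconst_eq_card_lex_pairs[OF assms(1)])
qed

lemma dmult_outside: "0 < p \<Longrightarrow> u \<notin> compositions n \<Longrightarrow> dmult n p x y u = 0"
  using dmult_dcarrier[of p n x y] by (simp add: dcarrier_def)

lemma dmult_dunit_left:
  assumes y: "y \<in> dcarrier n p" and n: "0 < n" and p: "0 < p"
  shows "dmult n p (dunit n) y = y"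
proof
  fix u
  let ?C = "compositions n"
  show "dmult n p (dunit n) y u = y u"
  proof (cases "u \<in> ?C")
    case True
    have "(\<Sum>q\<in>?C. \<Sum>r\<in>?C. dunit n q * y r * int (sconst q r u)) =
      (\<Sum>q\<in>?C. if q = [n] then \<Sum>r\<in>?C. y r * int (sconst [n] r u) else 0)"
      by (rule sum.cong) (auto simp: dunit_def)
    also have "\<dots> = (\<Sum>r\<in>?C. if r = u then y r else 0)"
      using singleton_composition[OF n] True
      by (simp add: finite_compositions sconst_unit_left if_distrib cong: sum.cong if_cong)
    also have "\<dots> = y u" using True by (simp add: finite_compositions)
    finally show ?thesis using dcarrier_mod[OF y] by (simp add: dmult_def)
  next
    case False
    then show ?thesis using y p dmult_outside[OF p False] by (simp add: dcarrier_def)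
  qed
qed

lemma dmult_dunit_right:
  assumes y: "y \<in> dcarrier n p" and n: "0 < n" and p: "0 < p"
  shows "dmult n p y (dunit n) = y"
proof
  fix u
  let ?C = "compositions n"
  show "dmult n p y (dunit n) u = y u"
  proof (cases "u \<in> ?C")
    case True
    have "(\<Sum>q\<in>?C. \<Sum>r\<in>?C. y q * dunit n r * int (sconst q r u)) =
      (\<Sum>q\<in>?C. \<Sum>r\<in>?C. if r = [n] then y q * int (sconst q [n] u) else 0)"
      by (intro sum.cong) (auto simp: dunit_def)
    also have "\<dots> = (\<Sum>q\<in>?C. y q * int (sconst q [n] u))"
      using singleton_composition[OF n] by (simp add: finite_compositions)
    also have "\<dots> = (\<Sum>q\<in>?C. if q = u then y q else 0)"
      using True by (intro sum.cong) (auto simp: sconst_unit_right)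
    also have "\<dots> = y u" using True by (simp add: finite_compositions)
    finally show ?thesis using dcarrier_mod[OF y] by (simp add: dmult_def)
  next
    case False
    then show ?thesis using y p dmult_outside[OF p False] by (simp add: dcarrier_def)
  qed
qed

section \<open>Kernels of characters are maximal left ideals\<close>

lemma left_ideal_character_kernel:
  assumes l: "l \<in> compositions n" and p: "0 < p"
  shows "left_ideal n p (character_kernel n p l)"
proof -
  have "[character n l (dadd p x y) = 0] (mod int p)"
    if "[character n l x = 0] (mod int p)" "[character n l y = 0] (mod int p)" for x y
    using cong_trans[OF fusion_count_dadd cong_add[OF that]] by simp
  moreover have "[character n l (dneg p x) = 0] (mod int p)"
    if "[character n l x = 0] (mod int p)" for x
    using cong_trans[OF fusion_count_dneg] that by (metis cong_minus_minus_iff minus_zero)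
  moreover have "[character n l (dmult n p a x) = 0] (mod int p)"
    if "[character n l x = 0] (mod int p)" for a x
    using cong_trans[OF character_dmult[OF l] cong_mult[OF cong_refl that]] by simp
  ultimately show ?thesis
    using p by (auto simp: left_ideal_def character_kernel_def dzero_dcarrier dadd_dcarrier
        dneg_dcarrier dmult_dcarrier)
qed

lemma common_kernel_eq:
  "0 < n \<Longrightarrow> common_kernel n p = (\<Inter>l\<in>compositions n. character_kernel n p l)"
  using singleton_composition[of n] by (auto simp: common_kernel_def character_kernel_def)

lemma left_ideal_Inter:
  assumes "K \<noteq> {}" "\<And>I. I \<in> K \<Longrightarrow> left_ideal n p I"
  shows "left_ideal n p (\<Inter>K)"
proof -
  have sub: "I \<subseteq> dcarrier n p" and zero: "dzero \<in> I"
    and add: "\<And>x y. x \<in> I \<Longrightarrow> y \<in> I \<Longrightarrow> dadd p x y \<in> I"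
    and neg: "\<And>x. x \<in> I \<Longrightarrow> dneg p x \<in> I"
    and mult: "\<And>a x. a \<in> dcarrier n p \<Longrightarrow> x \<in> I \<Longrightarrow> dmult n p a x \<in> I" if "I \<in> K" for I
    using assms(2)[OF that] by (simp_all add: left_ideal_def)
  have "\<Inter>K \<subseteq> dcarrier n p" using assms(1) sub by blast
  moreover have "dzero \<in> \<Inter>K" using zero by blast
  moreover have "dadd p x y \<in> \<Inter>K" if "x \<in> \<Inter>K" "y \<in> \<Inter>K" for x y
    using add that by simp
  moreover have "dneg p x \<in> \<Inter>K" if "x \<in> \<Inter>K" for x
    using neg that by simp
  moreover have "dmult n p a x \<in> \<Inter>K" if "a \<in> dcarrier n p" "x \<in> \<Inter>K" for a x
    using mult that by simp
  ultimately show ?thesis unfolding left_ideal_def by simp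
qed

lemma left_ideal_common_kernel:
  assumes "0 < n" "0 < p"
  shows "left_ideal n p (common_kernel n p)"
  unfolding common_kernel_eq[OF assms(1)]
  using singleton_composition[OF assms(1)] left_ideal_character_kernel assms(2)
  by (intro left_ideal_Inter) auto

text \<open>The argument is \<open>c\<close> times the identity. Such scalars make each character
  onto F_p and provide the inverse needed for maximality.\<close>

lemma character_scalar:
  assumes "l \<in> compositions n" "0 < n"
  shows "character n l (\<lambda>q. if q = [n] then c else 0) = c"
  using singleton_composition[OF assms(2)]
  by (simp add: fusion_count_def if_distrib[of "\<lambda>x. x * _"] finite_compositions
      fusions_singleton[OF assms(1)] cong: if_cong)

lemma left_ideal_with_dunit:
  assumes I: "left_ideal n p I" and "dunit n \<in> I" and "0 < n" "0 < p"
  shows "I = dcarrier n p"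
proof
  show "I \<subseteq> dcarrier n p" using I by (simp add: left_ideal_def)
  show "dcarrier n p \<subseteq> I"
  proof
    fix x assume x: "x \<in> dcarrier n p"
    then have "dmult n p x (dunit n) \<in> I" using assms(1,2) by (simp add: left_ideal_def)
    then show "x \<in> I" using dmult_dunit_right[OF x assms(3,4)] by simp
  qed
qed

lemma dadd_dneg_cancel: "x \<in> dcarrier n p \<Longrightarrow> dadd p (dadd p x (dneg p y)) y = x"
  by (rule ext) (simp add: dadd_def dneg_def mod_simps dcarrier_mod)

text \<open>The quotient by the kernel is F_p. Concretely, an element \<open>a\<close> of a larger
  left ideal outside the kernel is scaled to an element \<open>d\<close> of character 1. The
  difference of the identity and \<open>d\<close> lies in the kernel, and adding \<open>d\<close>
  back puts the identity into the larger ideal.\<close>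

lemma maximal_character_kernel:
  assumes l: "l \<in> compositions n" and n: "0 < n" and p: "prime p"
  shows "maximal_left_ideal n p (character_kernel n p l)"
proof -
  have p0: "0 < p" and p1: "1 < p" using p prime_gt_0_nat prime_gt_1_nat by auto
  let ?K = "character_kernel n p l"
  have unit: "character n l (dunit n) = 1"
    using character_scalar[OF l n] by (simp add: dunit_def)
  have "dunit n \<notin> ?K"
    using p1 by (simp add: character_kernel_def unit cong_def)
  then have ne: "?K \<noteq> dcarrier n p" using dunit_dcarrier[OF n p1] by auto
  have max: "L = dcarrier n p" if L: "left_ideal n p L" and KL: "?K \<subseteq> L" and neq: "L \<noteq> ?K" for L
  proof -
    obtain a where a: "a \<in> L" "a \<notin> ?K" using KL neq by auto
    have "a \<in> dcarrier n p" using a L by (auto simp: left_ideal_def)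
    then have "\<not> int p dvd character n l a" using a by (simp add: character_kernel_def cong_0_iff)
    then have "coprime (character n l a) (int p)"
      using p by (simp add: prime_imp_coprime coprime_commute)
    then obtain c where c: "[character n l a * c = 1] (mod int p)"
      using cong_solve_coprime_int by blast
    define e where "e = (\<lambda>q. if q = [n] then c mod int p else 0)"
    have e: "e \<in> dcarrier n p"
      using p0 singleton_composition[OF n] by (auto simp: e_def dcarrier_def)
    define d where "d = dmult n p e a"
    have dL: "d \<in> L" using L a(1) e by (simp add: left_ideal_def d_def)
    have "[character n l d = (c mod int p) * character n l a] (mod int p)"
      using character_dmult[OF l, of p e a] character_scalar[OF l n] by (simp add: d_def e_def)
    also have "[(c mod int p) * character n l a = 1] (mod int p)"
      using c by (simp add: cong_def mod_mult_left_eq mult.commute)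
    finally have d1: "[character n l d = 1] (mod int p)" .
    define k where "k = dadd p (dunit n) (dneg p d)"
    have "[character n l k = 1 + - character n l d] (mod int p)"
      unfolding k_def using cong_trans[OF fusion_count_dadd cong_add[OF cong_refl fusion_count_dneg]]
      by (metis unit)
    also have "[1 + - character n l d = 1 + - 1] (mod int p)"
      using d1 by (intro cong_add cong_refl) (simp add: cong_minus_minus_iff)
    finally have "[character n l k = 0] (mod int p)" by simp
    moreover have "k \<in> dcarrier n p"
      unfolding k_def d_def by (intro dadd_dcarrier dneg_dcarrier dunit_dcarrier dmult_dcarrier n p0 p1)
    ultimately have "k \<in> L" using KL by (auto simp: character_kernel_def)
    then have "dadd p k d \<in> L" using L dL by (simp add: left_ideal_def)
    then have "dunit n \<in> L"
      unfolding k_def by (simp add: dadd_dneg_cancel[OF dunit_dcarrier[OF n p1]])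
    then show ?thesis using left_ideal_with_dunit[OF L _ n p0] by simp
  qed
  show ?thesis
    unfolding maximal_left_ideal_def using left_ideal_character_kernel[OF l p0] ne max by blast
qed

section \<open>Nilpotent left ideals and the radical\<close>

lemma left_ideal_sum:
  assumes I: "left_ideal n p I" and J: "left_ideal n p J" and p: "0 < p"
  shows "left_ideal n p {dadd p x y | x y. x \<in> I \<and> y \<in> J}"
proof -
  have 1: "dadd p (dadd p x y) (dadd p x' y') = dadd p (dadd p x x') (dadd p y y')" for x y x' y'
    unfolding dadd_def mod_simps by (simp add: add_ac)
  have 2: "dneg p (dadd p x y) = dadd p (dneg p x) (dneg p y)" for x y
    by (rule ext) (simp add: dadd_def dneg_def mod_simps)
  have 3: "dzero = dadd p dzero dzero" by (simp add: dadd_def dzero_def)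
  show ?thesis
    unfolding left_ideal_def
  proof (intro conjI ballI)
    show "{dadd p x y |x y. x \<in> I \<and> y \<in> J} \<subseteq> dcarrier n p"
      using I J p by (auto simp: left_ideal_def intro!: dadd_dcarrier)
    show "dzero \<in> {dadd p x y |x y. x \<in> I \<and> y \<in> J}"
      using I J 3 by (auto simp: left_ideal_def)
    fix a assume "a \<in> {dadd p x y |x y. x \<in> I \<and> y \<in> J}"
    then obtain x y where a: "a = dadd p x y" "x \<in> I" "y \<in> J" by auto
    show "dneg p a \<in> {dadd p x y |x y. x \<in> I \<and> y \<in> J}"
      using I J a unfolding a 2 left_ideal_def by blast
    fix b assume "b \<in> {dadd p x y |x y. x \<in> I \<and> y \<in> J}"
    then obtain x' y' where b: "b = dadd p x' y'" "x' \<in> I" "y' \<in> J" by auto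
    show "dadd p a b \<in> {dadd p x y |x y. x \<in> I \<and> y \<in> J}"
      using I J a b unfolding a b 1 left_ideal_def by blast
  next
    fix b a assume b: "b \<in> dcarrier n p" and "a \<in> {dadd p x y |x y. x \<in> I \<and> y \<in> J}"
    then obtain x y where a: "a = dadd p x y" "x \<in> I" "y \<in> J" by auto
    show "dmult n p b a \<in> {dadd p x y |x y. x \<in> I \<and> y \<in> J}"
      using I J a b unfolding a dmult_dadd_right left_ideal_def by blast
  qed
qed

text \<open>Otherwise M + J is everything and 1 = m + j. Multiplying by the i-th power of j gives
  j^i = j^i m + j^(i+1), so 1 - j^i lies in M for every i by induction, and j^k = 0 puts 1 into M.
  Powers are formed by repeated right multiplication, which is also how \<open>ideal_pow\<close>
  nests its products.\<close>

lemma nilpotent_left_ideal_subset_maximal: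
  assumes M: "maximal_left_ideal n p M" and J: "left_ideal n p J" and n: "0 < n" and p: "1 < p"
    and nil: "\<And>j. j \<in> J \<Longrightarrow> ((\<lambda>x. dmult n p x j) ^^ k) (dunit n) = dzero"
  shows "J \<subseteq> M"
proof (rule ccontr)
  assume nJM: "\<not> J \<subseteq> M"
  have p0: "0 < p" using p by simp
  have Ml: "left_ideal n p M" using M by (simp add: maximal_left_ideal_def)
  let ?S = "{dadd p x y | x y. x \<in> M \<and> y \<in> J}"
  have z: "dadd p x dzero = x" "dadd p dzero x = x" if "x \<in> dcarrier n p" for x
    using dcarrier_mod[OF that] by (auto simp: dadd_def dzero_def)
  have MS: "M \<subseteq> ?S"
  proof
    fix x assume x: "x \<in> M"
    then have "x = dadd p x dzero" using z Ml by (auto simp: left_ideal_def)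
    then show "x \<in> ?S" using x J by (auto simp: left_ideal_def)
  qed
  have JS: "J \<subseteq> ?S"
  proof
    fix x assume x: "x \<in> J"
    then have "x = dadd p dzero x" using z J by (auto simp: left_ideal_def)
    then show "x \<in> ?S" using x Ml by (auto simp: left_ideal_def)
  qed
  have "?S = dcarrier n p"
  proof -
    have "\<forall>J. left_ideal n p J \<and> M \<subseteq> J \<longrightarrow> J = M \<or> J = dcarrier n p"
      using M by (simp add: maximal_left_ideal_def)
    then have "?S = M \<or> ?S = dcarrier n p"
      using left_ideal_sum[OF Ml J p0] MS by (elim allE[of _ ?S]) simp
    moreover have "?S \<noteq> M" using JS nJM by metis
    ultimately show ?thesis by metis
  qed
  then have "dunit n \<in> ?S" using dunit_dcarrier[OF n p] by metis
  then obtain m j where mj: "dunit n = dadd p m j" "m \<in> M" "j \<in> J"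
    by auto
  define pw where "pw i = ((\<lambda>x. dmult n p x j) ^^ i) (dunit n)" for i
  have pwc: "pw i \<in> dcarrier n p" for i
    by (cases i) (simp_all add: pw_def dunit_dcarrier[OF n p] dmult_dcarrier[OF p0])
  have "dadd p (dunit n) (dneg p (pw i)) \<in> M" for i
  proof (induction i)
    case 0
    have "dadd p (dunit n) (dneg p (pw 0)) = dzero"
      by (rule ext) (simp add: pw_def dadd_def dneg_def dzero_def mod_simps)
    then show ?case using Ml by (simp add: left_ideal_def)
  next
    case (Suc i)
    have "pw i = dmult n p (pw i) (dunit n)" using dmult_dunit_right[OF pwc n p0] by simp
    also have "\<dots> = dadd p (dmult n p (pw i) m) (pw (Suc i))"
      unfolding mj(1) dmult_dadd_right by (simp add: pw_def)
    finally have pwi: "pw i = dadd p (dmult n p (pw i) m) (pw (Suc i))" .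
    have "dadd p (dadd p (dunit n) (dneg p (pw i))) (dmult n p (pw i) m) =
        dadd p (dunit n) (dneg p (pw (Suc i)))"
      by (subst pwi, rule ext) (simp add: dadd_def dneg_def mod_simps)
    moreover have "dmult n p (pw i) m \<in> M" using Ml mj(2) pwc by (simp add: left_ideal_def)
    ultimately show ?case using Suc Ml by (metis left_ideal_def)
  qed
  from this[of k] have "dadd p (dunit n) (dneg p dzero) \<in> M" by (simp add: pw_def nil[OF mj(3)])
  moreover have "dneg p dzero = dzero" by (simp add: dneg_def dzero_def)
  ultimately have "dunit n \<in> M" using z dunit_dcarrier[OF n p] by simp
  then have "M = dcarrier n p" using left_ideal_with_dunit[OF Ml _ n p0] by simp
  then show False using M by (simp add: maximal_left_ideal_def)
qed

text \<open>Nilpotency is an assumption at this point; it is supplied by the upper bound, which is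
  proved for the common kernel and so does not depend on this identification.\<close>

lemma jrad_eq_common_kernel:
  assumes n: "0 < n" and p: "prime p"
    and nil: "\<And>j. j \<in> common_kernel n p \<Longrightarrow> ((\<lambda>x. dmult n p x j) ^^ k) (dunit n) = dzero"
  shows "jrad n p = common_kernel n p"
proof
  show "jrad n p \<subseteq> common_kernel n p"
    using maximal_character_kernel[OF _ n p] unfolding common_kernel_eq[OF n] jrad_def by blast
  have "0 < p" "1 < p" using p prime_gt_0_nat prime_gt_1_nat by auto
  then show "common_kernel n p \<subseteq> jrad n p"
    using nilpotent_left_ideal_subset_maximal[OF _ left_ideal_common_kernel[OF n] n _ nil]
    by (auto simp: jrad_def common_kernel_def)
qed

section \<open>Multiplying by an element of the radical\<close>

text \<open>The codegeneracy map of the simplex category: the increasing surjection that identifies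
  \<open>i\<close> and \<open>Suc i\<close>. Accordingly \<open>face_comp\<close> is one of the
  simplicial identities.\<close>

definition face :: "nat \<Rightarrow> nat \<Rightarrow> nat" where
  "face i k = (if k \<le> i then k else k - 1)"

lemma face_less: "k < Suc m \<Longrightarrow> i < m \<Longrightarrow> face i k < m"
  by (auto simp: face_def)

lemma face_image: "i < m \<Longrightarrow> face i ` {..<Suc m} = {..<m}"
proof (intro antisym subsetI)
  fix k assume "i < m" "k \<in> {..<m}"
  then have "k = face i (if k \<le> i then k else Suc k)" "(if k \<le> i then k else Suc k) \<in> {..<Suc m}"
    by (auto simp: face_def)
  then show "k \<in> face i ` {..<Suc m}" by blast
qed (auto simp: face_less)

lemma face_comp: "d \<le> i \<Longrightarrow> face i (face d k) = face d (face (Suc i) k)"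
  by (auto simp: face_def)

lemma mono_surj_id:
  fixes h :: "nat \<Rightarrow> nat"
  assumes im: "h ` {..<m} = {..<m}" and mono: "\<And>a b. a < b \<Longrightarrow> b < m \<Longrightarrow> h a \<le> h b" and k: "k < m"
  shows "h k = k"
proof -
  have "inj_on h {..<m}" by (rule eq_card_imp_inj_on) (simp_all add: im)
  then have lt: "h a < h b" if "a < b" "b < m" for a b
    using mono[OF that] that by (auto simp: inj_on_def order.order_iff_strict)
  have eq: "[0..<m] = map h [0..<m]"
    by (rule strict_mono_lists_eqI) (simp_all add: lt im lessThan_atLeast0[symmetric])
  show ?thesis using arg_cong[OF eq, of "\<lambda>xs. xs ! k"] k by simp
qed

text \<open>One index too many forces a repeated value, and monotonicity makes the repetition
  adjacent.\<close>

lemma mono_surj_face: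
  fixes f :: "nat \<Rightarrow> nat"
  assumes im: "f ` {..<Suc m} = {..<m}"
    and mono: "\<And>a b. a < b \<Longrightarrow> b < Suc m \<Longrightarrow> f a \<le> f b"
  shows "\<exists>i<m. \<forall>k<Suc m. f k = face i k"
proof -
  have "\<not> inj_on f {..<Suc m}" using card_image[of f "{..<Suc m}"] im by auto
  then obtain a b where ab: "a < b" "b < Suc m" "f a = f b"
    unfolding inj_on_def by (metis lessThan_iff linorder_neqE_nat)
  have eq: "f (Suc a) = f a"
    using mono[of a "Suc a"] mono[of "Suc a" b] ab by (cases "Suc a = b") auto
  have am: "a < m" using ab by simp
  \<comment> \<open>Leaving out the index \<open>Suc a\<close>, whose value occurs already at
    \<open>a\<close>, gives an increasing map of the first \<open>m\<close> numbers onto themselves,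
    hence the identity.\<close>
  define h where "h k = f (if k \<le> a then k else Suc k)" for k
  have "h ` {..<m} = {..<m}"
  proof (rule antisym)
    have "f k < m" if "k < Suc m" for k using im that by blast
    then show "h ` {..<m} \<subseteq> {..<m}" by (auto simp: h_def)
    show "{..<m} \<subseteq> h ` {..<m}"
    proof
      fix j assume "j \<in> {..<m}"
      then obtain k where k: "k < Suc m" "f k = j" using im by (metis imageE lessThan_iff)
      show "j \<in> h ` {..<m}"
      proof (cases "k \<le> a")
        case True
        then show ?thesis using k am by (intro image_eqI[of _ _ k]) (auto simp: h_def)
      next
        case False
        then obtain k' where k': "k = Suc k'" by (cases k) auto
        then have "h k' = j" using k eq False by (cases "k' = a") (simp_all add: h_def)
        then show ?thesis using k k' by (intro image_eqI[of _ _ k']) auto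
      qed
    qed
  qed
  moreover have "h x \<le> h y" if "x < y" "y < m" for x y
    using that by (auto simp: h_def intro!: mono)
  ultimately have hid: "h k = k" if "k < m" for k using mono_surj_id[of h m] that by blast
  have "f k = face a k" if "k < Suc m" for k
  proof (cases "k \<le> a")
    case True
    then show ?thesis using hid[of k] am by (simp add: h_def face_def)
  next
    case False
    then obtain k' where k': "k = Suc k'" by (cases k) auto
    show ?thesis using hid[of k'] hid[of a] eq that am False k'
      by (cases "k' = a") (simp_all add: h_def face_def)
  qed
  then show ?thesis using am by blast
qed

lemma lex_increasing_mono: "lex_increasing m f g \<Longrightarrow> a < b \<Longrightarrow> b < m \<Longrightarrow> f a \<le> f b"
  by (force simp: lex_increasing_def)

text \<open>The only tie among the values of \<open>f\<close> is between \<open>i\<close> and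
  \<open>Suc i\<close>, so this pair alone constrains \<open>g\<close>.\<close>

lemma lex_increasing_face:
  assumes "i < m" "\<And>k. k < Suc m \<Longrightarrow> f k = face i k"
  shows "lex_increasing (Suc m) f g \<longleftrightarrow> g i < g (Suc i)"
proof -
  have "f a < f b \<or> a = i \<and> b = Suc i \<and> f a = f b" if "a < b" "b < Suc m" for a b
    using that assms by (auto simp: face_def)
  moreover have "f i = f (Suc i)" using assms by (simp add: face_def)
  ultimately show ?thesis using assms(1) unfolding lex_increasing_def
    by (metis Suc_mono lessI less_irrefl)
qed

text \<open>Sorting the pairs by their first component isolates \<open>y\<close>: for fixed
  \<open>f\<close>, what remains is a weighted count of the \<open>g\<close> compatible with
  it.\<close>

lemma sum_sconst_eq:
  assumes u: "u \<in> compositions n"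
  shows "(\<Sum>r\<in>compositions n. y r * int (sconst q r u)) =
    (\<Sum>f\<in>fusions u q. fusion_count n u (lex_increasing (length u) f) y)"
proof -
  have "int (sconst q r u) = (\<Sum>f\<in>fusions u q. int (card {g \<in> fusions u r. lex_increasing (length u) f g}))" for r
  proof -
    have "lex_pairs q r u = (SIGMA f:fusions u q. {g \<in> fusions u r. lex_increasing (length u) f g})"
      by (auto simp: lex_pairs_def)
    then show ?thesis
      by (simp add: sconst_eq_card_lex_pairs[OF u] finite_fusions)
  qed
  then show ?thesis
    unfolding fusion_count_def by (simp add: sum_distrib_left) (rule sum.swap)
qed

lemma dmult_apply_cong:
  assumes u: "u \<in> compositions n"
  shows "[dmult n p z y u = (\<Sum>q\<in>compositions n. z q *
    (\<Sum>f\<in>fusions u q. fusion_count n u (lex_increasing (length u) f) y))] (mod int p)"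
  unfolding sum_sconst_eq[OF u, symmetric]
  by (simp add: dmult_def cong_def sum_distrib_left mult.assoc)

lemma fusion_count_False: "(\<And>g. \<not> P g) \<Longrightarrow> fusion_count n u P y = 0"
  by (simp add: fusion_count_def)

text \<open>Here membership in the common kernel acts. A compatible \<open>f\<close> is onto and
  increasing between ranges of equal length, hence the identity; it has no ties, so \<open>g\<close>
  is unconstrained and its weighted count is a character of \<open>y\<close>.\<close>

lemma sum_lex_increasing_long:
  assumes u: "u \<in> compositions n" and q: "q \<in> compositions n" and y: "y \<in> common_kernel n p"
    and len: "length u \<le> length q"
  shows "[(\<Sum>f\<in>fusions u q. fusion_count n u (lex_increasing (length u) f) y) = 0] (mod int p)"
proof -
  have "[fusion_count n u (lex_increasing (length u) f) y = 0] (mod int p)" if f: "f \<in> fusions u q" for f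
  proof (cases "\<exists>g. lex_increasing (length u) f g")
    case False
    then show ?thesis using fusion_count_False[of "lex_increasing (length u) f"] by simp
  next
    case True
    then obtain g where g: "lex_increasing (length u) f g" ..
    have "length q = length u" using len fusions_length_le[OF f q] by simp
    then have "f k = k" if "k < length u" for k
      using mono_surj_id[of f "length u", OF _ lex_increasing_mono[OF g]] fusions_image[OF f q] that by simp
    then have "lex_increasing (length u) f = (\<lambda>_. True)"
      by (auto simp: lex_increasing_def fun_eq_iff)
    then show ?thesis using y u by (simp add: common_kernel_def)
  qed
  then have "[(\<Sum>f\<in>fusions u q. fusion_count n u (lex_increasing (length u) f) y) =
      (\<Sum>f\<in>fusions u q. 0)] (mod int p)"
    by (rule cong_sum)
  then show ?thesis by simp
qed

abbreviation merge :: "nat list \<Rightarrow> nat \<Rightarrow> nat list" where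
  "merge u i \<equiv> fuse u (face i) (length u - 1)"

lemma face_fusion:
  assumes "length u = Suc m" "i < m"
  shows "restrict (face i) {..<Suc m} \<in> fusions u (merge u i)"
proof -
  have "merge u i = fuse u (restrict (face i) {..<Suc m}) m"
    using assms by (auto intro: fuse_cong)
  moreover have "restrict (face i) {..<Suc m} \<in> {..<length u} \<rightarrow>\<^sub>E {..<m}"
    unfolding assms(1) using assms(2) face_less by (auto simp: restrict_PiE_iff)
  ultimately show ?thesis using fuse_in_fusions by metis
qed

lemma merge_composition:
  assumes "u \<in> compositions n" "length u = Suc m" "i < m"
  shows "merge u i \<in> compositions n"
  by (rule fuse_composition[OF assms(1)]) (use assms face_image in simp)

text \<open>An \<open>f\<close> that is not increasing admits no compatible \<open>g\<close>, and an
  increasing \<open>f\<close> onto one part fewer is a face map. Several \<open>i\<close> may lead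
  to the same merged composition; the sum over \<open>i\<close> counts each of these fusions
  separately.\<close>

lemma sum_merge:
  assumes u: "u \<in> compositions n" and len: "length u = Suc m"
  shows "(\<Sum>q\<in>{q \<in> compositions n. length q = m}.
      z q * (\<Sum>f\<in>fusions u q. fusion_count n u (lex_increasing (length u) f) y)) =
    (\<Sum>i<m. z (merge u i) * fusion_count n u (\<lambda>g. g i < g (Suc i)) y)"
proof -
  let ?Q = "{q \<in> compositions n. length q = m}"
  let ?N = "\<lambda>f. fusion_count n u (lex_increasing (length u) f) y"
  let ?e = "\<lambda>i. (merge u i, restrict (face i) {..<Suc m})"
  let ?D = "SIGMA q:?Q. fusions u q"
  have finQ: "finite ?Q" using finite_compositions by simp
  have inj: "inj_on ?e {..<m}"
  proof (rule inj_onI)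
    fix i j assume ij: "i \<in> {..<m}" "j \<in> {..<m}" and "?e i = ?e j"
    then have *: "restrict (face i) {..<Suc m} = restrict (face j) {..<Suc m}" by simp
    have "face i k = face j k" if "k < Suc m" for k
      using fun_cong[OF *, of k] that by simp
    \<comment> \<open>For i < j the two faces differ at \<open>Suc i\<close>, with values
      \<open>i\<close> and \<open>Suc i\<close>.\<close>
    from this[of "Suc i"] this[of "Suc j"] show "i = j" using ij by (auto simp: face_def split: if_splits)
  qed
  have sub: "?e ` {..<m} \<subseteq> ?D"
    using face_fusion[OF len] merge_composition[OF u len] len by auto
  have "(\<Sum>q\<in>?Q. z q * (\<Sum>f\<in>fusions u q. ?N f)) = (\<Sum>q\<in>?Q. \<Sum>f\<in>fusions u q. z q * ?N f)"
    by (simp add: sum_distrib_left)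
  also have "\<dots> = (\<Sum>(q, f)\<in>?D. z q * ?N f)"
    by (rule sum.Sigma) (use finQ finite_fusions in auto)
  also have "\<dots> = (\<Sum>(q, f)\<in>?e ` {..<m}. z q * ?N f)"
  proof (rule sum.mono_neutral_right)
    show "finite ?D" using finQ finite_fusions by auto
    show "?e ` {..<m} \<subseteq> ?D" by (rule sub)
    show "\<forall>x\<in>?D - ?e ` {..<m}. (case x of (q, f) \<Rightarrow> z q * ?N f) = 0"
    proof clarify
      fix q f assume q: "q \<in> compositions n" "m = length q" and f: "f \<in> fusions u q"
        and ne: "(q, f) \<notin> (\<lambda>i. (merge u i, restrict (face i) {..<Suc (length q)})) ` {..<length q}"
      have "\<not> lex_increasing (length u) f g" for g
      proof
        assume "lex_increasing (length u) f g"
        note mono = lex_increasing_mono[OF this]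
        have "f ` {..<Suc m} = {..<m}" using fusions_image[OF f q(1)] q len by simp
        then obtain i where i: "i < m" "\<forall>k<Suc m. f k = face i k"
          using mono_surj_face[of f m] mono len by auto
        have "f = restrict (face i) {..<Suc m}"
        proof
          fix k show "f k = restrict (face i) {..<Suc m} k"
            using i f len by (cases "k < Suc m") (auto simp: fusions_def PiE_def extensional_def)
        qed
        moreover have "q = merge u i"
        proof -
          have "q = fuse u f m" using f q by (simp add: fusions_iff)
          also have "\<dots> = fuse u (face i) m" by (rule fuse_cong) (use i len in simp)
          finally show ?thesis using len by simp
        qed
        ultimately show False using ne i(1) q(2) by blast
      qed
      then show "z q * ?N f = 0" using fusion_count_False[of "lex_increasing (length u) f"] by simp
    qed
  qed
  also have "\<dots> = (\<Sum>i<m. z (merge u i) * ?N (restrict (face i) {..<Suc m}))"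
    by (subst sum.reindex[OF inj]) simp
  also have "\<dots> = (\<Sum>i<m. z (merge u i) * fusion_count n u (\<lambda>g. g i < g (Suc i)) y)"
  proof (rule sum.cong[OF refl])
    fix i assume "i \<in> {..<m}"
    then have "lex_increasing (Suc m) (restrict (face i) {..<Suc m}) = (\<lambda>g. g i < g (Suc i))"
      by (intro ext lex_increasing_face) auto
    then show "z (merge u i) * ?N (restrict (face i) {..<Suc m}) =
        z (merge u i) * fusion_count n u (\<lambda>g. g i < g (Suc i)) y"
      unfolding len by simp
  qed
  finally show ?thesis .
qed

text \<open>Compositions \<open>q\<close> with fewer than \<open>m\<close> parts are killed by
  \<open>z\<close>, those with more than \<open>m\<close> parts by \<open>y\<close>; only the single
  merges of \<open>u\<close> survive.\<close>

lemma dmult_leading_coefficient: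
  assumes u: "u \<in> compositions n" and len: "length u = Suc m" and y: "y \<in> common_kernel n p"
    and z: "\<And>q. q \<in> compositions n \<Longrightarrow> length q < m \<Longrightarrow> z q = 0"
  shows "[dmult n p z y u =
    (\<Sum>i<m. z (merge u i) * fusion_count n u (\<lambda>g. g i < g (Suc i)) y)] (mod int p)"
proof -
  let ?N = "\<lambda>q. \<Sum>f\<in>fusions u q. fusion_count n u (lex_increasing (length u) f) y"
  note dmult_apply_cong[OF u, of p z y]
  also have "[(\<Sum>q\<in>compositions n. z q * ?N q) =
      (\<Sum>q\<in>compositions n. if length q = m then z q * ?N q else 0)] (mod int p)"
  proof (rule cong_sum)
    fix q assume q: "q \<in> compositions n"
    show "[z q * ?N q = (if length q = m then z q * ?N q else 0)] (mod int p)"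
    proof (cases "length q" m rule: linorder_cases)
      case greater
      then have "[?N q = 0] (mod int p)" using sum_lex_increasing_long[OF u q y] len by simp
      then have "[z q * ?N q = z q * 0] (mod int p)" by (intro cong_mult cong_refl)
      then show ?thesis using greater by simp
    qed (use z[OF q] in auto)
  qed
  also have "(\<Sum>q\<in>compositions n. if length q = m then z q * ?N q else 0) =
      (\<Sum>q\<in>{q \<in> compositions n. length q = m}. z q * ?N q)"
    using finite_compositions by (subst sum.inter_filter) auto
  also have "\<dots> = (\<Sum>i<m. z (merge u i) * fusion_count n u (\<lambda>g. g i < g (Suc i)) y)"
    by (rule sum_merge[OF u len])
  finally show ?thesis .
qed

text \<open>Every \<open>q\<close> not killed by \<open>z\<close> is at least as long as
  \<open>u\<close> and is killed by \<open>y\<close>. Thus each factor from the common kernel raises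
  the filtration by one.\<close>

lemma dmult_short:
  assumes u: "u \<in> compositions n" and len: "length u \<le> m" and y: "y \<in> common_kernel n p"
    and z: "\<And>q. q \<in> compositions n \<Longrightarrow> length q < m \<Longrightarrow> z q = 0" and p: "0 < p"
  shows "dmult n p z y u = 0"
proof -
  let ?N = "\<lambda>q. \<Sum>f\<in>fusions u q. fusion_count n u (lex_increasing (length u) f) y"
  note dmult_apply_cong[OF u, of p z y]
  also have "[(\<Sum>q\<in>compositions n. z q * ?N q) = (\<Sum>q\<in>compositions n. 0)] (mod int p)"
  proof (rule cong_sum)
    fix q assume q: "q \<in> compositions n"
    show "[z q * ?N q = 0] (mod int p)"
    proof (cases "length q < m")
      case False
      then have "[?N q = 0] (mod int p)" using sum_lex_increasing_long[OF u q y] len by simp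
      then have "[z q * ?N q = z q * 0] (mod int p)" by (intro cong_mult cong_refl)
      then show ?thesis by simp
    qed (use z[OF q] in simp)
  qed
  finally have "[dmult n p z y u = 0] (mod int p)" by simp
  \<comment> \<open>Coefficients of a product are reduced representatives, so congruence to 0 is
    equality.\<close>
  then show ?thesis using dmult_dcarrier[OF p, of n z y] by (simp add: cong_def dcarrier_def)
qed

lemma fusion_count_reindex:
  assumes "bij_betw \<pi> {..<length u} {..<length v}"
    and "\<And>k. k < length u \<Longrightarrow> v ! \<pi> k = u ! k"
    and "\<And>g g'. (\<And>k. k < length u \<Longrightarrow> g k = g' k) \<Longrightarrow> P g \<longleftrightarrow> P g'"
  shows "fusion_count n v (\<lambda>g. P (\<lambda>k. g (\<pi> k))) y = fusion_count n u P y"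
  unfolding fusion_count_def using fusions_bij_reindex[of \<pi> u v P, OF assms] by simp

lemma fusion_count_disj:
  assumes "\<And>g. \<not> (P g \<and> Q g)"
  shows "fusion_count n u (\<lambda>g. P g \<or> Q g) y = fusion_count n u P y + fusion_count n u Q y"
proof -
  have "card {g \<in> fusions u r. P g \<or> Q g} = card {g \<in> fusions u r. P g} + card {g \<in> fusions u r. Q g}" for r
    by (subst card_Un_disjoint[symmetric]) (use assms finite_fusions in \<open>auto intro!: arg_cong[of _ _ card]\<close>)
  then show ?thesis by (simp add: fusion_count_def distrib_left sum.distrib)
qed

text \<open>Fusions that agree on \<open>i\<close> and \<open>Suc i\<close> are those that factor
  through merging the two parts. Hence the count of ties is again a character and vanishes on the
  common kernel.\<close>

lemma fusion_count_merge:
  assumes len: "length u = Suc m" and i: "i < m"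
  shows "fusion_count n u (\<lambda>g. g i = g (Suc i)) y = character n (merge u i) y"
proof -
  let ?f = "restrict (face i) {..<Suc m}"
  have f: "?f \<in> fusions u (merge u i)" by (rule face_fusion[OF len i])
  have lenm: "length (merge u i) = m" using len by simp
  have "card {g \<in> fusions u r. g i = g (Suc i)} = card (fusions (merge u i) r)" for r
  proof (rule bij_betw_same_card[symmetric])
    show "bij_betw (\<lambda>g. compose {..<length u} g ?f) (fusions (merge u i) r) {g \<in> fusions u r. g i = g (Suc i)}"
      unfolding bij_betw_def
    proof
      show "inj_on (\<lambda>g. compose {..<length u} g ?f) (fusions (merge u i) r)"
      proof (rule inj_onI)
        fix g g' assume g: "g \<in> fusions (merge u i) r" "g' \<in> fusions (merge u i) r"
          and eq: "compose {..<length u} g ?f = compose {..<length u} g' ?f"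
        show "g = g'"
        proof
          fix k show "g k = g' k"
          proof (cases "k < m")
            case True
            then obtain k' where "k' < Suc m" "face i k' = k"
              using face_image[OF i] by (metis imageE lessThan_iff)
            then show ?thesis using fun_cong[OF eq, of k'] len by (simp add: compose_def)
          qed (use g lenm in \<open>auto simp: fusions_def PiE_def extensional_def\<close>)
        qed
      qed
      show "(\<lambda>g. compose {..<length u} g ?f) ` fusions (merge u i) r = {g \<in> fusions u r. g i = g (Suc i)}"
      proof (intro antisym subsetI)
        fix h assume "h \<in> (\<lambda>g. compose {..<length u} g ?f) ` fusions (merge u i) r"
        then obtain g where g: "g \<in> fusions (merge u i) r" and h: "h = compose {..<length u} g ?f" by auto
        have "h \<in> fusions u r"
          using compose_fusions_iff[OF f, of g r] g h by (simp add: fusions_def)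
        moreover have "h i = h (Suc i)" using h len i by (simp add: compose_def face_def)
        ultimately show "h \<in> {g \<in> fusions u r. g i = g (Suc i)}" by simp
      next
        fix h assume "h \<in> {g \<in> fusions u r. g i = g (Suc i)}"
        then have h: "h \<in> fusions u r" and hi: "h i = h (Suc i)" by auto
        define g where "g = restrict (\<lambda>k. h (if k \<le> i then k else Suc k)) {..<m}"
        have gE: "g \<in> {..<length (merge u i)} \<rightarrow>\<^sub>E {..<length r}"
          using fusions_less[OF h] len by (auto simp: g_def)
        have hg: "h = compose {..<length u} g ?f"
        proof
          fix k show "h k = compose {..<length u} g ?f k"
          proof (cases "k < Suc m")
            case True
            then show ?thesis using hi i len face_less[OF True i]
              by (cases "k = Suc i") (auto simp: compose_def g_def face_def)
          qed (use h len in \<open>auto simp: fusions_def PiE_def extensional_def compose_def\<close>)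
        qed
        then have "g \<in> fusions (merge u i) r"
          using compose_fusions_iff[OF f gE] h by simp
        then show "h \<in> (\<lambda>g. compose {..<length u} g ?f) ` fusions (merge u i) r"
          using hg by blast
      qed
    qed
  qed
  then show ?thesis by (simp add: fusion_count_def)
qed

section \<open>The radical has nilpotency index at most n - 1\<close>

lemma nth_merge:
  assumes "length u = Suc m" "d < m" "k < m"
  shows "merge u d ! k = (if k < d then u ! k else if k = d then u ! d + u ! Suc d else u ! Suc k)"
proof -
  have "{k' \<in> {..<length u}. face d k' = k} =
      (if k < d then {k} else if k = d then {d, Suc d} else {Suc k})"
    using assms by (auto simp: face_def split: if_splits)
  then show ?thesis using assms by (simp add: fiber_sum_def)
qed

text \<open>The shift to \<open>Suc i\<close> accounts for the part lost by merging at
  \<open>d\<close> first. In the cancellation this identity gives two paired terms the same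
  coefficient.\<close>

lemma merge_merge:
  assumes "length u = Suc (Suc m)" "d \<le> i" "i < m"
  shows "merge (merge u d) i = merge (merge u (Suc i)) d"
proof -
  have "merge (merge u d) i = fuse u (\<lambda>k. face i (face d k)) m"
    using fuse_fuse[of u "face d" "Suc m"] assms by (simp add: face_less)
  also have "\<dots> = fuse u (\<lambda>k. face d (face (Suc i) k)) m"
    using face_comp[OF assms(2)] by simp
  also have "\<dots> = merge (merge u (Suc i)) d"
    using fuse_fuse[of u "face (Suc i)" "Suc m"] assms by (simp add: face_less)
  finally show ?thesis .
qed

abbreviation ones :: "nat \<Rightarrow> nat list" where
  "ones n \<equiv> replicate n 1"

lemma ones_composition: "ones n \<in> compositions n"
  by (simp add: compositions_def sum_list_replicate)

text \<open>These lists, a single 2 at position \<open>d\<close> among ones, are the compositions of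
  \<open>n\<close> with n - 1 parts.\<close>

lemma nth_merge_ones:
  assumes "n = Suc (Suc m)" "d < Suc m" "k < Suc m"
  shows "merge (ones n) d ! k = (if k = d then 2 else 1)"
proof -
  have "merge (ones n) d ! k = (if k < d then ones n ! k
      else if k = d then ones n ! d + ones n ! Suc d else ones n ! Suc k)"
    by (rule nth_merge) (use assms in auto)
  then show ?thesis using assms by (simp del: nth_fuse replicate_Suc)
qed

text \<open>Reversing the positions from d to i + 1 exchanges the two sides, up to the direction of
  the inequality; what remains is a difference of two characters of y.\<close>

lemma fusion_count_merge_ones_cancel:
  assumes y: "y \<in> common_kernel n p" and n: "n = Suc (Suc m)" and d: "d \<le> i" and i: "i < m"
  shows "[fusion_count n (merge (ones n) d) (\<lambda>g. g i < g (Suc i)) y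
    + fusion_count n (merge (ones n) (Suc i)) (\<lambda>g. g d < g (Suc d)) y = 0] (mod int p)"
proof -
  let ?u = "merge (ones n) d" and ?v = "merge (ones n) (Suc i)"
  have len: "length ?u = Suc m" "length ?v = Suc m" using n by simp_all
  have uC: "?u \<in> compositions n"
    by (rule merge_composition[OF ones_composition]) (use n d i in auto)
  have muC: "merge ?u i \<in> compositions n" by (rule merge_composition[OF uC len(1) i])
  define \<pi> where "\<pi> k = (if d \<le> k \<and> k \<le> Suc i then d + Suc i - k else k)" for k
  have \<pi>\<pi>: "\<pi> (\<pi> k) = k" for k by (auto simp: \<pi>_def)
  have \<pi>l: "\<pi> k < Suc m" if "k < Suc m" for k using that d i by (auto simp: \<pi>_def)
  have "bij_betw \<pi> {..<length ?u} {..<length ?v}"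
    unfolding len by (rule bij_betw_byWitness[of _ \<pi>]) (use \<pi>\<pi> \<pi>l in auto)
  moreover have "?v ! \<pi> k = ?u ! k" if k: "k < length ?u" for k
  proof -
    have "?v ! \<pi> k = (if \<pi> k = Suc i then 2 else 1)"
      using nth_merge_ones[OF n, of "Suc i" "\<pi> k"] \<pi>l[of k] k len i by simp
    moreover have "?u ! k = (if k = d then 2 else 1)"
      using nth_merge_ones[OF n, of d k] k len d i by simp
    moreover have "\<pi> k = Suc i \<longleftrightarrow> k = d" using d by (auto simp: \<pi>_def)
    ultimately show ?thesis by metis
  qed
  ultimately have "fusion_count n ?v (\<lambda>g. g (\<pi> (Suc i)) < g (\<pi> i)) y =
      fusion_count n ?u (\<lambda>g. g (Suc i) < g i) y"
    by (rule fusion_count_reindex[where P = "\<lambda>g. g (Suc i) < g i"]) (use len i in auto)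
  moreover have "\<pi> (Suc i) = d" "\<pi> i = Suc d" using d by (auto simp: \<pi>_def)
  ultimately have "fusion_count n ?u (\<lambda>g. g i < g (Suc i)) y + fusion_count n ?v (\<lambda>g. g d < g (Suc d)) y
      = fusion_count n ?u (\<lambda>g. g i < g (Suc i) \<or> g (Suc i) < g i) y"
    by (subst fusion_count_disj) auto
  also have "\<dots> = character n ?u y - character n (merge ?u i) y"
  proof -
    have "(\<lambda>g :: nat \<Rightarrow> nat. True) = (\<lambda>g. (g i < g (Suc i) \<or> g (Suc i) < g i) \<or> g i = g (Suc i))"
      by (rule ext) (metis linorder_neqE_nat)
    then have "character n ?u y =
        fusion_count n ?u (\<lambda>g. (g i < g (Suc i) \<or> g (Suc i) < g i) \<or> g i = g (Suc i)) y"
      by (simp only:)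
    also have "\<dots> = fusion_count n ?u (\<lambda>g. g i < g (Suc i) \<or> g (Suc i) < g i) y
        + fusion_count n ?u (\<lambda>g. g i = g (Suc i)) y"
      by (rule fusion_count_disj) auto
    finally show ?thesis using fusion_count_merge[OF len(1) i] by simp
  qed
  finally have eq: "fusion_count n ?u (\<lambda>g. g i < g (Suc i)) y + fusion_count n ?v (\<lambda>g. g d < g (Suc d)) y
      = character n ?u y - character n (merge ?u i) y" .
  have "[character n ?u y - character n (merge ?u i) y = 0 - 0] (mod int p)"
    using y uC muC by (intro cong_diff) (auto simp: common_kernel_def)
  then show ?thesis unfolding eq by (simp only: diff_zero)
qed

text \<open>The rectangle is cut along the diagonal, and (d, i) is matched with (Suc i, d), the
  partner given by \<open>merge_merge\<close>.\<close>

lemma sum_triangle_split: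
  fixes F :: "nat \<Rightarrow> nat \<Rightarrow> int"
  shows "(\<Sum>d<Suc m. \<Sum>i<m. F d i) = (\<Sum>(d, i)\<in>{(d, i). d \<le> i \<and> i < m}. F d i + F (Suc i) d)"
proof -
  let ?D = "{(d, i). d \<le> i \<and> i < m}" and ?E = "{(d, i). i < d \<and> d < Suc m}"
  have fin: "finite ?D" "finite ?E"
    by (rule finite_subset[of _ "{..<Suc m} \<times> {..<Suc m}"]; auto)+
  have "(\<Sum>d<Suc m. \<Sum>i<m. F d i) = (\<Sum>(d, i)\<in>{..<Suc m} \<times> {..<m}. F d i)"
    by (rule sum.cartesian_product)
  also have "{..<Suc m} \<times> {..<m} = ?D \<union> ?E" by auto
  also have "(\<Sum>(d, i)\<in>?D \<union> ?E. F d i) = (\<Sum>(d, i)\<in>?D. F d i) + (\<Sum>(d, i)\<in>?E. F d i)"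
    by (rule sum.union_disjoint) (use fin in auto)
  also have "(\<Sum>(d, i)\<in>?E. F d i) = (\<Sum>(d, i)\<in>?D. F (Suc i) d)"
    by (rule sum.reindex_bij_witness[of _ "\<lambda>(d, i). (Suc i, d)" "\<lambda>(d, i). (i, d - 1)"]) auto
  finally show ?thesis by (simp add: sum.distrib[symmetric] split_def)
qed

text \<open>The terms of a matched pair share their coefficient of \<open>x\<close>, since both
  double merges are the same composition, while their weights add up to 0 modulo p.\<close>

lemma sum_dmult_merge_ones:
  assumes y: "y \<in> common_kernel n p" and n: "n = Suc (Suc m)"
    and x: "\<And>q. q \<in> compositions n \<Longrightarrow> length q < m \<Longrightarrow> x q = 0"
  shows "[(\<Sum>d<Suc m. dmult n p x y (merge (ones n) d)) = 0] (mod int p)"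
proof -
  let ?u = "merge (ones n)"
  let ?F = "\<lambda>d i. x (merge (?u d) i) * fusion_count n (?u d) (\<lambda>g. g i < g (Suc i)) y"
  have cancel: "[?F d i + ?F (Suc i) d = 0] (mod int p)" if di: "d \<le> i" "i < m" for d i
  proof -
    have "merge (?u (Suc i)) d = merge (?u d) i"
      by (rule merge_merge[symmetric]) (use n di in auto)
    then have eq: "?F d i + ?F (Suc i) d = x (merge (?u d) i) *
      (fusion_count n (?u d) (\<lambda>g. g i < g (Suc i)) y + fusion_count n (?u (Suc i)) (\<lambda>g. g d < g (Suc d)) y)"
      by (simp only: distrib_left)
    show ?thesis
      unfolding eq using cong_mult[OF cong_refl fusion_count_merge_ones_cancel[OF y n di]]
      by (simp only: mult_zero_right)
  qed
  have "[(\<Sum>d<Suc m. dmult n p x y (?u d)) = (\<Sum>d<Suc m. \<Sum>i<m. ?F d i)] (mod int p)"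
  proof (rule cong_sum)
    fix d assume "d \<in> {..<Suc m}"
    then show "[dmult n p x y (?u d) = (\<Sum>i<m. ?F d i)] (mod int p)"
      by (intro dmult_leading_coefficient[OF merge_composition[OF ones_composition, of n "Suc m" d] _ y x])
        (use n in auto)
  qed
  also have "(\<Sum>d<Suc m. \<Sum>i<m. ?F d i) =
      (\<Sum>(d, i)\<in>{(d, i). d \<le> i \<and> i < m}. ?F d i + ?F (Suc i) d)"
    by (rule sum_triangle_split)
  also have "[\<dots> = (\<Sum>(d, i)\<in>{(d, i). d \<le> i \<and> i < m}. 0)] (mod int p)"
    by (rule cong_sum) (use cancel in auto)
  finally show ?thesis by simp
qed

text \<open>All parts are equal, so a cyclic shift by \<open>i\<close> moves the positions 0 and 1
  to \<open>i\<close> and \<open>Suc i\<close>.\<close>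

lemma fusion_count_ones:
  assumes "Suc i < n"
  shows "fusion_count n (ones n) (\<lambda>g. g i < g (Suc i)) y = fusion_count n (ones n) (\<lambda>g. g 0 < g (Suc 0)) y"
proof -
  define \<pi> where "\<pi> k = (if k < n - i then k + i else k + i - n)" for k
  have "bij_betw \<pi> {..<n} {..<n}"
    by (rule bij_betw_byWitness[of _ "\<lambda>k. if i \<le> k then k - i else k + n - i"])
      (use assms in \<open>auto simp: \<pi>_def\<close>)
  moreover have "\<pi> k < n" if "k < n" for k using assms that by (auto simp: \<pi>_def)
  ultimately have "fusion_count n (ones n) (\<lambda>g. g (\<pi> 0) < g (\<pi> (Suc 0))) y
    = fusion_count n (ones n) (\<lambda>g. g 0 < g (Suc 0)) y"
    by (intro fusion_count_reindex[where P = "\<lambda>g. g 0 < g (Suc 0)"])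
      (use assms in auto)
  moreover have "\<pi> 0 = i" "\<pi> (Suc 0) = Suc i" using assms by (auto simp: \<pi>_def)
  ultimately show ?thesis by simp
qed

text \<open>Only the coefficient of \<open>ones n\<close> can survive, and its n - 1 merges all
  carry the same weight; the coefficient is this weight times the sum assumed to vanish.\<close>

lemma dmult_eq_dzero:
  assumes y: "y \<in> common_kernel n p" and n: "n = Suc (Suc m)" and p: "0 < p"
    and z: "\<And>q. q \<in> compositions n \<Longrightarrow> length q < Suc m \<Longrightarrow> z q = 0"
    and sum: "[(\<Sum>d<Suc m. z (merge (ones n) d)) = 0] (mod int p)"
  shows "dmult n p z y = dzero"
proof
  fix u
  have "dmult n p z y u = 0"
  proof (cases "u \<in> compositions n")
    case False
    then show ?thesis by (rule dmult_outside[OF p])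
  next
    case u: True
    show ?thesis
    proof (cases "length u \<le> Suc m")
      case True
      then show ?thesis by (rule dmult_short[OF u _ y z p])
    next
      case False
      then have "length u = n" using length_composition_le[OF u] n by simp
      then have ones: "u = ones n" by (rule composition_length_n[OF u])
      let ?c = "fusion_count n (ones n) (\<lambda>g. g 0 < g (Suc 0)) y"
      have "[dmult n p z y u = (\<Sum>i<Suc m. z (merge u i) * fusion_count n u (\<lambda>g. g i < g (Suc i)) y)] (mod int p)"
        by (rule dmult_leading_coefficient[OF u _ y z]) (use n \<open>length u = n\<close> in auto)
      also have "(\<Sum>i<Suc m. z (merge u i) * fusion_count n u (\<lambda>g. g i < g (Suc i)) y)
          = (\<Sum>i<Suc m. z (merge (ones n) i) * ?c)"
        unfolding ones
      proof (rule sum.cong[OF refl])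
        fix i assume "i \<in> {..<Suc m}"
        then have "fusion_count n (ones n) (\<lambda>g. g i < g (Suc i)) y = ?c"
          by (intro fusion_count_ones) (use n in simp)
        then show "z (merge (ones n) i) * fusion_count n (ones n) (\<lambda>g. g i < g (Suc i)) y =
            z (merge (ones n) i) * ?c" by (simp only:)
      qed
      also have "\<dots> = (\<Sum>i<Suc m. z (merge (ones n) i)) * ?c" by (simp only: sum_distrib_right)
      also have "[\<dots> = 0 * ?c] (mod int p)" by (intro cong_mult sum cong_refl)
      finally have "[dmult n p z y u = 0] (mod int p)" by simp
      then show ?thesis using dmult_dcarrier[OF p, of n z y] by (simp add: cong_def dcarrier_def)
    qed
  qed
  then show "dmult n p z y u = dzero u" by (simp add: dzero_def)
qed

section \<open>Powers of the common kernel\<close>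

text \<open>\<open>ideal_pow\<close> treats exponent 1 separately, as \<open>R\<close> itself
  instead of a closure of products. Writing b as the product of the identity with b brings this case
  under the same product condition.\<close>

lemma ideal_pow_Suc_subset:
  assumes n: "0 < n" and p: "1 < p" and R: "R \<subseteq> dcarrier n p"
    and zero: "dzero \<in> P" and add: "\<And>x y. x \<in> P \<Longrightarrow> y \<in> P \<Longrightarrow> dadd p x y \<in> P"
    and mult: "\<And>a b. a \<in> ideal_pow n p R k \<Longrightarrow> b \<in> R \<Longrightarrow> dmult n p a b \<in> P"
  shows "ideal_pow n p R (Suc k) \<subseteq> P"
proof (cases k)
  case 0
  have "b \<in> P" if "b \<in> R" for b
    using mult[of "dunit n" b] that dunit_dcarrier[OF n p] dmult_dunit_left[of b n p] n p R 0 by auto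
  then show ?thesis using 0 by auto
next
  case (Suc k')
  have "x \<in> P" if "x \<in> addclose p {dmult n p a b | a b. a \<in> ideal_pow n p R (Suc k') \<and> b \<in> R}" for x
    using that by induction (use zero add mult Suc in auto)
  then show ?thesis using Suc by auto
qed

lemma ideal_pow_filtration:
  assumes n: "0 < n" and p: "1 < p"
  shows "ideal_pow n p (common_kernel n p) k \<subseteq>
    {z \<in> dcarrier n p. \<forall>q\<in>compositions n. length q < Suc k \<longrightarrow> z q = 0}"
proof (induction k)
  case 0
  \<comment> \<open>For exponent 0 the condition concerns only the empty list, which is no
    composition of a positive number.\<close>
  show ?case using length_composition_pos[OF _ n] by fastforce
next
  case (Suc k)
  show ?case
  proof (rule ideal_pow_Suc_subset[OF n p])
    show "common_kernel n p \<subseteq> dcarrier n p" by (auto simp: common_kernel_def)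
  next
    fix a b assume a: "a \<in> ideal_pow n p (common_kernel n p) k" and b: "b \<in> common_kernel n p"
    have "dmult n p a b q = 0" if "q \<in> compositions n" "length q \<le> Suc k" for q
      by (rule dmult_short[OF that b]) (use a Suc p in auto)
    then show "dmult n p a b \<in> {z \<in> dcarrier n p. \<forall>q\<in>compositions n. length q < Suc (Suc k) \<longrightarrow> z q = 0}"
      using p by (simp add: dmult_dcarrier)
  qed (use p in \<open>auto simp: dzero_dcarrier dadd_dcarrier\<close>, auto simp: dzero_def dadd_def)
qed

text \<open>The exponent is n - 2, at least 1 because n is at least 3, so there is a last factor
  from the common kernel on which the cancellation can act.\<close>

lemma ideal_pow_sum_merge_ones:
  assumes n: "n = Suc (Suc (Suc m))" and p: "1 < p"
  shows "ideal_pow n p (common_kernel n p) (Suc m) \<subseteq>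
    {z. [(\<Sum>d<Suc (Suc m). z (merge (ones n) d)) = 0] (mod int p)}"
proof (rule ideal_pow_Suc_subset[OF _ p])
  show "0 < n" using n by simp
  show "common_kernel n p \<subseteq> dcarrier n p" by (auto simp: common_kernel_def)
  show "dzero \<in> {z. [(\<Sum>d<Suc (Suc m). z (merge (ones n) d)) = 0] (mod int p)}"
    by (simp add: dzero_def)
next
  fix x y assume "x \<in> {z. [(\<Sum>d<Suc (Suc m). z (merge (ones n) d)) = 0] (mod int p)}"
    "y \<in> {z. [(\<Sum>d<Suc (Suc m). z (merge (ones n) d)) = 0] (mod int p)}"
  then have "[(\<Sum>d<Suc (Suc m). x (merge (ones n) d)) + (\<Sum>d<Suc (Suc m). y (merge (ones n) d)) = 0 + 0] (mod int p)"
    by (intro cong_add) simp_all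
  moreover have "[(\<Sum>d<Suc (Suc m). dadd p x y (merge (ones n) d)) =
      (\<Sum>d<Suc (Suc m). x (merge (ones n) d) + y (merge (ones n) d))] (mod int p)"
    by (rule cong_sum) (simp add: dadd_def cong_def)
  ultimately show "dadd p x y \<in> {z. [(\<Sum>d<Suc (Suc m). z (merge (ones n) d)) = 0] (mod int p)}"
    unfolding sum.distrib by (simp add: cong_def)
next
  fix a b assume "a \<in> ideal_pow n p (common_kernel n p) m" and b: "b \<in> common_kernel n p"
  then have "a q = 0" if "q \<in> compositions n" "length q < Suc m" for q
    using ideal_pow_filtration[of n p m] n p that by auto
  from sum_dmult_merge_ones[OF b n this]
  show "dmult n p a b \<in> {z. [(\<Sum>d<Suc (Suc m). z (merge (ones n) d)) = 0] (mod int p)}"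
    by simp
qed

lemma ideal_pow_common_kernel_eq_dzero:
  assumes n: "3 \<le> n" and p: "1 < p"
  shows "ideal_pow n p (common_kernel n p) (n - 1) = {dzero}"
proof -
  define m where "m = n - 3"
  have n: "n = Suc (Suc (Suc m))" using n by (simp add: m_def)
  have "ideal_pow n p (common_kernel n p) (Suc (Suc m)) \<subseteq> {dzero}"
  proof (rule ideal_pow_Suc_subset[OF _ p])
    fix a b assume a: "a \<in> ideal_pow n p (common_kernel n p) (Suc m)" and b: "b \<in> common_kernel n p"
    have "dmult n p a b = dzero"
    proof (rule dmult_eq_dzero[OF b n])
      show "[(\<Sum>d<Suc (Suc m). a (merge (ones n) d)) = 0] (mod int p)"
        using ideal_pow_sum_merge_ones[OF n p] a by auto
      show "a q = 0" if "q \<in> compositions n" "length q < Suc (Suc m)" for q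
        using ideal_pow_filtration[of n p "Suc m"] a n p that by auto
    qed (use p in simp)
    then show "dmult n p a b \<in> {dzero}" by simp
  qed (use n in \<open>auto simp: common_kernel_def dadd_def dzero_def\<close>)
  moreover have "dzero \<in> ideal_pow n p (common_kernel n p) (Suc (Suc m))" by (simp add: ac_zero)
  ultimately show ?thesis using n by auto
qed

text \<open>Used twice: to get nilpotency of single elements from a vanishing power, and to place
  the nonzero product in its power.\<close>

lemma funpow_dmult_in_ideal_pow:
  assumes j: "j \<in> R" "R \<subseteq> dcarrier n p" and n: "0 < n" and p: "1 < p"
  shows "((\<lambda>x. dmult n p x j) ^^ k) (dunit n) \<in> ideal_pow n p R k"
proof (induction k)
  case 0
  show ?case using dunit_dcarrier[OF n p] by simp
next
  case (Suc k)
  show ?case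
  proof (cases k)
    case 0
    then show ?thesis using j n p by (simp add: dmult_dunit_left subset_eq)
  next
    case (Suc k')
    show ?thesis using Suc.IH j(1) unfolding Suc by (auto intro!: ac_base)
  qed
qed

section \<open>A nonzero product of n - 2 radical elements\<close>

text \<open>The value \<open>int p - 1\<close> represents -1 in the range of coefficients. For n at
  least 3 the two compositions are distinct.\<close>

definition two_part_witness :: "nat \<Rightarrow> nat \<Rightarrow> nat list \<Rightarrow> int" where
  "two_part_witness n p q = (if q = [1, n - 1] then 1 else if q = [n - 1, 1] then int p - 1 else 0)"

lemma two_part_compositions: "2 \<le> n \<Longrightarrow> [1, n - 1] \<in> compositions n" "2 \<le> n \<Longrightarrow> [n - 1, 1] \<in> compositions n"
  by (auto simp: compositions_def)

text \<open>Exchanging the two targets replaces \<open>g k\<close> by \<open>1 - g k\<close>;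
  truncated subtraction is an involution because the values are 0 and 1.\<close>

lemma card_fusions_swap:
  assumes P: "\<And>g g'. (\<And>k. k < length u \<Longrightarrow> g k = g' k) \<Longrightarrow> P g \<longleftrightarrow> P g'"
  shows "card {g \<in> fusions u [b, a]. P g} = card {g \<in> fusions u [a, b]. P (\<lambda>k. 1 - g k)}"
proof -
  let ?s = "\<lambda>g. restrict (\<lambda>k. 1 - g k) {..<length u}"
  have lt: "g k = 0 \<or> g k = 1" if "g \<in> fusions u [a, b]" "k < length u" for g k a b
    using fusions_less[OF that] by auto
  have inv: "?s (?s g) = g" if g: "g \<in> fusions u [a, b]" for g a b
  proof
    fix k show "?s (?s g) k = g k"
      using lt[OF g, of k] g by (cases "k < length u") (auto simp: fusions_def PiE_def extensional_def)
  qed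
  have swap: "?s g \<in> fusions u [b, a]" if g: "g \<in> fusions u [a, b]" for g a b
  proof -
    have "fiber_sum u (?s g) j = fiber_sum u g (1 - j)" if "j < 2" for j
      unfolding fiber_sum_def
    proof (rule sum.cong[OF _ refl])
      show "{k \<in> {..<length u}. ?s g k = j} = {k \<in> {..<length u}. g k = 1 - j}"
        using lt[OF g] that by (auto; fastforce)
    qed
    then show ?thesis
      using g by (auto simp: fusions_def less_Suc_eq numeral_2_eq_2)
  qed
  have Ps: "P (?s g) \<longleftrightarrow> P (\<lambda>k. 1 - g k)" for g by (rule P) simp
  have Pss: "P (\<lambda>k. 1 - ?s g k) \<longleftrightarrow> P g" if "g \<in> fusions u [a, b]" for g a b
  proof (rule P)
    fix k assume "k < length u"
    then show "1 - ?s g k = g k" using lt[OF that, of k] by auto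
  qed
  show ?thesis
    by (rule bij_betw_same_card[of ?s], rule bij_betw_byWitness[of _ ?s])
      (use inv swap Ps Pss in auto)
qed

lemma fusion_count_two_part_witness:
  assumes n: "3 \<le> n"
  shows "[fusion_count n u P (two_part_witness n p) =
    int (card {g \<in> fusions u [1, n - 1]. P g}) - int (card {g \<in> fusions u [n - 1, 1]. P g})] (mod int p)"
proof -
  let ?c = "\<lambda>q. int (card {g \<in> fusions u q. P g})"
  have "fusion_count n u P (two_part_witness n p) =
      (\<Sum>r\<in>compositions n. (if r = [1, n - 1] then ?c [1, n - 1] else 0)
        + (if r = [n - 1, 1] then (int p - 1) * ?c [n - 1, 1] else 0))"
    unfolding fusion_count_def by (rule sum.cong) (use n in \<open>auto simp: two_part_witness_def\<close>)
  also have "\<dots> = ?c [1, n - 1] + (int p - 1) * ?c [n - 1, 1]"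
    using n two_part_compositions[of n] by (simp add: sum.distrib finite_compositions)
  finally have eq: "fusion_count n u P (two_part_witness n p) =
      ?c [1, n - 1] + (int p - 1) * ?c [n - 1, 1]" .
  show ?thesis unfolding eq by (simp add: cong_iff_dvd_diff algebra_simps)
qed

text \<open>A character does not see the order of the two parts of the target, so it takes equal
  values on the two basis elements, whatever p is.\<close>

lemma two_part_witness_common_kernel:
  assumes n: "3 \<le> n" and p: "1 < p"
  shows "two_part_witness n p \<in> common_kernel n p"
proof -
  have "two_part_witness n p \<in> dcarrier n p"
    using n p two_part_compositions[of n] by (auto simp: dcarrier_def two_part_witness_def)
  moreover have "[character n l (two_part_witness n p) = 0] (mod int p)" for l
    using fusion_count_two_part_witness[OF n, of l "\<lambda>_. True" p]
      card_fusions_swap[of l "\<lambda>_. True" "n - 1" 1] by simp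
  ultimately show ?thesis by (simp add: common_kernel_def)
qed

text \<open>Exchanging the two targets turns the subtracted count into one onto the first target
  with the inequality reversed; exchanging the equal parts \<open>i\<close> and \<open>Suc i\<close>
  reverses it back.\<close>

lemma fusion_count_two_part_witness_equal:
  assumes n: "3 \<le> n" and i: "Suc i < length u" and eq: "u ! i = u ! Suc i"
  shows "[fusion_count n u (\<lambda>g. g i < g (Suc i)) (two_part_witness n p) = 0] (mod int p)"
proof -
  let ?A = "fusions u [1, n - 1]"
  define \<pi> where "\<pi> k = (if k = i then Suc i else if k = Suc i then i else k)" for k
  have "bij_betw \<pi> {..<length u} {..<length u}"
    by (rule bij_betw_byWitness[of _ \<pi>]) (use i in \<open>auto simp: \<pi>_def\<close>)
  then have "card {g \<in> ?A. g (\<pi> i) < g (\<pi> (Suc i))} = card {g \<in> ?A. g i < g (Suc i)}"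
    by (rule fusions_bij_reindex[where P = "\<lambda>g. g i < g (Suc i)"]) (use i eq in \<open>auto simp: \<pi>_def\<close>)
  then have "card {g \<in> ?A. g (Suc i) < g i} = card {g \<in> ?A. g i < g (Suc i)}"
    by (simp add: \<pi>_def)
  moreover have "card {g \<in> fusions u [n - 1, 1]. g i < g (Suc i)} = card {g \<in> ?A. 1 - g i < 1 - g (Suc i)}"
    by (rule card_fusions_swap) (use i in auto)
  moreover have "{g \<in> ?A. 1 - g i < 1 - g (Suc i)} = {g \<in> ?A. g (Suc i) < g i}"
    using fusions_less[of _ u "[1, n - 1]" i] i by fastforce
  ultimately show ?thesis
    using fusion_count_two_part_witness[OF n, of u "\<lambda>g. g i < g (Suc i)" p] by simp
qed

text \<open>Onto [1, n - 1], part \<open>i\<close> fills the target of size 1 and everything else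
  goes to the other target, so there is exactly one fusion. Onto [n - 1, 1], part
  \<open>Suc i\<close> would have to fit into the target of size 1, which it exceeds.\<close>

lemma fusion_count_two_part_witness_last:
  assumes n: "3 \<le> n" and u: "u \<in> compositions n" and i: "Suc i < length u"
    and ui: "u ! i = 1" "2 \<le> u ! Suc i"
  shows "[fusion_count n u (\<lambda>g. g i < g (Suc i)) (two_part_witness n p) = 1] (mod int p)"
proof -
  have none: "{g \<in> fusions u [n - 1, 1]. g i < g (Suc i)} = {}"
  proof -
    have False if g: "g \<in> fusions u [n - 1, 1]" and lt: "g i < g (Suc i)" for g
    proof -
      have "g (Suc i) = 1" using fusions_less[OF g i] lt by simp
      then have "u ! Suc i \<le> fiber_sum u g 1"
        unfolding fiber_sum_def by (intro member_le_sum) (use i in auto)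
      then show False using fusions_fiber[OF g, of 1] ui by simp
    qed
    then show ?thesis by auto
  qed
  let ?g = "restrict (\<lambda>k. if k = i then 0 else 1 :: nat) {..<length u}"
  have "{g \<in> fusions u [1, n - 1]. g i < g (Suc i)} = {?g}"
  proof (intro antisym subsetI)
    fix g assume "g \<in> {g \<in> fusions u [1, n - 1]. g i < g (Suc i)}"
    then have g: "g \<in> fusions u [1, n - 1]" and lt: "g i < g (Suc i)" by auto
    have gi: "g i = 0" using fusions_less[OF g i] lt by simp
    have "g k = 1" if k: "k < length u" "k \<noteq> i" for k
    proof (rule ccontr)
      assume "g k \<noteq> 1"
      then have gk: "g k = 0" using fusions_less[OF g k(1)] by simp
      \<comment> \<open>Part \<open>i\<close> already fills the target of size 1; a second positive
        part would overflow it.\<close>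
      have "(\<Sum>k\<in>{i, k}. u ! k) \<le> fiber_sum u g 0"
        unfolding fiber_sum_def by (rule sum_mono2) (use i k gi gk in auto)
      then show False
        using fusions_fiber[OF g, of 0] compositions_nth_pos[OF u k(1)] k(2) ui by simp
    qed
    then have "g = ?g" using g gi by (auto simp: fusions_def PiE_def extensional_def fun_eq_iff)
    then show "g \<in> {?g}" by simp
  next
    fix g assume "g \<in> {?g}"
    then have g: "g = ?g" by simp
    have "{k \<in> {..<length u}. ?g k = 0} = {i}" using i by auto
    then have f0: "fiber_sum u ?g 0 = 1" unfolding fiber_sum_def using ui by (simp only:) simp
    have "(\<Sum>j<2. fiber_sum u ?g j) = n"
      using sum_fiber_sum[of u ?g 2] compositions_sum[OF u] by simp
    then have "fiber_sum u ?g 1 = n - 1" using f0 by (simp add: numeral_2_eq_2)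
    then have "?g \<in> fusions u [1, n - 1]"
      using f0 by (auto simp: fusions_def less_Suc_eq)
    then show "g \<in> {g \<in> fusions u [1, n - 1]. g i < g (Suc i)}"
      using g i by simp
  qed
  then show ?thesis
    using fusion_count_two_part_witness[OF n, of u "\<lambda>g. g i < g (Suc i)" p] unfolding none by simp
qed

text \<open>In [1,...,1,n-k-1] every adjacent pair of ones has weight 0 and the last pair has weight
  1, so the coefficient is inherited from the merge of the last two parts, [1,...,1,n-k]. The bound
  on \<open>k\<close> keeps the last part at least 2, as weight 1 requires.\<close>

lemma funpow_two_part_witness:
  assumes n: "3 \<le> n" and p: "1 < p" and k: "k \<le> n - 2"
  shows "[((\<lambda>x. dmult n p x (two_part_witness n p)) ^^ k) (dunit n) (replicate k 1 @ [n - k]) = 1] (mod int p)"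
  using k
proof (induction k)
  case 0
  show ?case by (simp add: dunit_def)
next
  case (Suc k)
  let ?w = "two_part_witness n p"
  let ?z = "((\<lambda>x. dmult n p x ?w) ^^ k) (dunit n)"
  let ?u = "replicate (Suc k) 1 @ [n - Suc k]"
  have len: "length ?u = Suc (Suc k)" by simp
  have u: "?u \<in> compositions n"
    using Suc.prems n by (auto simp: compositions_def sum_list_replicate)
  have w: "?w \<in> common_kernel n p" by (rule two_part_witness_common_kernel[OF n p])
  have nth: "?u ! i = 1" if "i < Suc k" for i using that by (simp add: nth_append del: replicate_Suc)
  have last: "?u ! Suc k = n - Suc k" by (simp add: nth_append)
  have "?z \<in> ideal_pow n p (common_kernel n p) k"
    by (rule funpow_dmult_in_ideal_pow[OF w]) (use n p in \<open>auto simp: common_kernel_def\<close>)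
  then have z: "?z q = 0" if "q \<in> compositions n" "length q < Suc k" for q
    using ideal_pow_filtration[of n p k] n p that by auto
  have "[dmult n p ?z ?w ?u = (\<Sum>i<Suc k. ?z (merge ?u i) * fusion_count n ?u (\<lambda>g. g i < g (Suc i)) ?w)] (mod int p)"
    by (rule dmult_leading_coefficient[OF u len w]) (rule z)
  also have "[(\<Sum>i<Suc k. ?z (merge ?u i) * fusion_count n ?u (\<lambda>g. g i < g (Suc i)) ?w)
      = (\<Sum>i<Suc k. ?z (merge ?u i) * (if i = k then 1 else 0))] (mod int p)"
  proof (intro cong_sum cong_mult cong_refl)
    fix i assume i: "i \<in> {..<Suc k}"
    show "[fusion_count n ?u (\<lambda>g. g i < g (Suc i)) ?w = (if i = k then 1 else 0)] (mod int p)"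
    proof (cases "i = k")
      case True
      have "[fusion_count n ?u (\<lambda>g. g k < g (Suc k)) ?w = 1] (mod int p)"
        by (rule fusion_count_two_part_witness_last[OF n u])
          (use Suc.prems n len nth[of k] last in auto)
      then show ?thesis using True by simp
    next
      case False
      then have "?u ! i = ?u ! Suc i" using nth[of i] nth[of "Suc i"] i by simp
      then show ?thesis using False fusion_count_two_part_witness_equal[OF n, of i ?u p] i len by simp
    qed
  qed
  also have "(\<Sum>i<Suc k. ?z (merge ?u i) * (if i = k then 1 else 0)) = ?z (merge ?u k)"
    by simp
  also have "merge ?u k = replicate k 1 @ [n - k]"
  proof (rule nth_equalityI)
    fix i assume "i < length (merge ?u k)"
    then have i: "i < Suc k" by simp
    show "merge ?u k ! i = (replicate k 1 @ [n - k]) ! i"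
      using nth_merge[OF len, of k i] i nth[of i] nth[of k] last Suc.prems n
      by (auto simp: nth_append less_Suc_eq)
  qed simp
  also have "[?z (replicate k 1 @ [n - k]) = 1] (mod int p)" using Suc by simp
  finally show ?case by simp
qed

theorem theorem3p4:
  fixes n p :: nat
  assumes "prime p" and "n \<ge> 3"
  shows "ideal_pow n p (jrad n p) (n - 1) = {dzero} \<and>
         ideal_pow n p (jrad n p) (n - 2) \<noteq> {dzero}"
proof -
  have p: "1 < p" using assms(1) by (rule prime_gt_1_nat)
  have n: "0 < n" using assms(2) by simp
  have sub: "common_kernel n p \<subseteq> dcarrier n p" by (auto simp: common_kernel_def)
  note top = ideal_pow_common_kernel_eq_dzero[OF assms(2) p]
  \<comment> \<open>The vanishing power n - 1 of the common kernel is the nilpotency needed here,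
    with n - 1 as the common exponent for all its elements.\<close>
  have jrad: "jrad n p = common_kernel n p"
    using jrad_eq_common_kernel[OF n assms(1), of "n - 1"]
      funpow_dmult_in_ideal_pow[OF _ sub n p, of _ "n - 1"] top by auto
  let ?z = "((\<lambda>x. dmult n p x (two_part_witness n p)) ^^ (n - 2)) (dunit n)"
  \<comment> \<open>The composition is [1,...,1,2], the last one in the chain whose final part
    exceeds 1.\<close>
  have "[?z (replicate (n - 2) 1 @ [n - (n - 2)]) = 1] (mod int p)"
    by (rule funpow_two_part_witness[OF assms(2) p]) simp
  then have "?z \<noteq> dzero" using p by (auto simp: dzero_def cong_def)
  moreover have "?z \<in> ideal_pow n p (common_kernel n p) (n - 2)"
    by (rule funpow_dmult_in_ideal_pow[OF two_part_witness_common_kernel[OF assms(2) p] sub n p])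
  ultimately show ?thesis using top jrad by auto
qed

end
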